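(* For $n\ge1$ let $U_n$ be uniformly distributed on $\{1,\dots,n\}$. Suppose that $(\omega(U_n))_n$ (resp. $(\Omega(U_n))_n$) converges in the mod-Poisson sense at speed $\log\log n+\kappa$, for a certain constant $\kappa$, to a certain function $\Phi_\omega$ (resp. $\Phi_\Omega$), with a speed of convergence given by $$\frac{\mathbb E\big(x^{\omega(U_n)}\big)}{\mathbb E\big(x^{\mathcal P(\log\log n+\kappa)}\big)}=\Phi_\omega(x)\Big(1+O_x\Big(\frac1{\log n}\Big)\Big)$$ $$\Big(\text{resp. }\ \frac{\mathbb E\big(x^{\Omega(U_n)}\big)}{\mathbb E\big(x^{\mathcal P(\log\log n+\kappa)}\big)}=\Phi_\Omega(x)\Big(1+O_x\Big(\frac1{\log n}\Big)\Big)\Big).$$ Denote by $\Phi_{\widehat\omega}$ (resp. $\Phi_{\widehat\Omega}$) the limiting function of the independent model $\widehat\omega_n$ (resp. $\widehat\Omega_n$), namely $$\Phi_{\widehat\omega}(x)=\prod_{p\text{ prime}}\Big(1+\frac{x-1}{p}\Big)e^{-\frac{x-1}{p}},\qquad \Phi_{\widehat\Omega}(x)=\prod_{p\text{ prime}}\frac{1-\frac1p}{1-\frac xp}\,e^{-\frac{x-1}{p}}.$$ Then, necessarily, there exists $\widetilde\kappa\in\mathbb R$ such that $$\Phi_\omega(x)=\frac{e^{\widetilde\kappa(x-1)}}{\Gamma(x)}\,\Phi_{\widehat\omega}(x)\qquad\Big(\text{resp. }\ \Phi_\Omega(x)=\frac{e^{\widetilde\kappa(x-1)}}{\Gamma(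x)}\,\Phi_{\widehat\Omega}(x)\Big).$$
   Context: $\omega(k)$ is the number of distinct prime divisors of $k$, and $\Omega(k)$ is the number of prime divisors of $k$ counted with multiplicity. $\mathcal P(\lambda)$ is a Poisson random variable of parameter $\lambda$, so $\mathbb E(x^{\mathcal P(\lambda)})=e^{\lambda(x-1)}$. $\Gamma$ is the Gamma function. $O_x(\cdot)$ means that the implied constant may depend on $x$. Mod-Poisson convergence: a sequence $(X_n)_n$ of positive random variables converges in the mod-Poisson sense at speed $(\gamma_n)_n$ (strictly positive reals) to $\Phi$ if $\Phi:\mathbb C\to\mathbb C$ is a continuous function with $\Phi(1)=1$ and $\Phi(\overline z)=\overline{\Phi(z)}$, and $\mathbb E(z^{X_n})/\mathbb E(z^{\mathcal P(\gamma_n)})\to\Phi(z)$ as $n\to\infty$, locally uniformly in $z\in\mathbb C$. The independent models are $\widehat\omega_n=\sum_{p\le n}B_p$ and $\widehat\Omega_n=\sum_{p\le n}G_p$, where the sums run over primes, the $B_p$ are independent $\{0,1\}$-valued Bernoulli variables of parameter $1/p$, and the $G_p$ are independent geometric variables with $\mathbb P(G_p=k)=(1-\frac1p)p^{-k}$, $k\ge0$. *)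

theory Defs
  imports
    "HOL-Probability.Probability"
    "HOL-Computational_Algebra.Primes"
    "HOL-Library.Landau_Symbols"
begin

definition omega :: "nat \<Rightarrow> nat" where
  "omega k = card (prime_factors k)"

definition Omega :: "nat \<Rightarrow> nat" where
  "Omega k = size (prime_factorization k)"

text \<open>The quotient of \<open>E(z^X)\<close> by \<open>E(z^P)\<close>, where \<open>X\<close> has law \<open>p\<close> and \<open>P\<close> is Poisson with
  parameter \<open>c\<close>.\<close>

definition poisson_ratio :: "nat pmf \<Rightarrow> real \<Rightarrow> complex \<Rightarrow> complex" where
  "poisson_ratio p c z =
     measure_pmf.expectation p (\<lambda>k. z ^ k) / measure_pmf.expectation (poisson_pmf c) (\<lambda>k. z ^ k)"

text \<open>Mod-Poisson convergence at speed \<open>\<gamma>\<close> to \<open>\<Phi>\<close> on an open domain \<open>D\<close>; the usual notion is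
  \<open>D = UNIV\<close>. The variables are given by their laws. The speed is only required to be eventually
  positive, so that \<open>log log n + c\<close> is an admissible speed.\<close>

definition mod_poisson_on ::
    "complex set \<Rightarrow> (nat \<Rightarrow> nat pmf) \<Rightarrow> (nat \<Rightarrow> real) \<Rightarrow> (complex \<Rightarrow> complex) \<Rightarrow> bool" where
  "mod_poisson_on D X \<gamma> \<Phi> \<longleftrightarrow>
     (\<forall>\<^sub>F n in sequentially. 0 < \<gamma> n) \<and>
     continuous_on D \<Phi> \<and> \<Phi> 1 = 1 \<and> (\<forall>z\<in>D. \<Phi> (cnj z) = cnj (\<Phi> z)) \<and>
     (\<forall>z\<in>D. \<forall>\<^sub>F n in sequentially. integrable (measure_pmf (X n)) (\<lambda>k. z ^ k)) \<and>
     (\<forall>z\<in>D. \<exists>d>0. cball z d \<subseteq> D \<and>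
        uniform_limit (cball z d) (\<lambda>n. poisson_ratio (X n) (\<gamma> n)) \<Phi> sequentially)"

text \<open>The ratio equals \<open>\<Phi>(x) (1 + O\<^sub>x(1 / log n))\<close>, for every real \<open>x > 0\<close> in \<open>D\<close>. This cannot be
  asked at all complex \<open>x\<close>: for \<open>\<omega>\<close> the limit vanishes at \<open>x = 0\<close> whereas the ratio does not.\<close>

definition log_rate_on ::
    "complex set \<Rightarrow> (nat \<Rightarrow> nat pmf) \<Rightarrow> (nat \<Rightarrow> real) \<Rightarrow> (complex \<Rightarrow> complex) \<Rightarrow> bool" where
  "log_rate_on D X \<gamma> \<Phi> \<longleftrightarrow>
     (\<forall>x::real. 0 < x \<and> complex_of_real x \<in> D \<longrightarrow>
        (\<exists>r :: nat \<Rightarrow> complex. r \<in> O(\<lambda>n. complex_of_real (1 / ln (real n))) \<and>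
           (\<forall>\<^sub>F n in sequentially.
              poisson_ratio (X n) (\<gamma> n) (complex_of_real x) = \<Phi> (complex_of_real x) * (1 + r n))))"

text \<open>For \<open>n = 0\<close> the set is empty and the law unspecified, which is irrelevant asymptotically.\<close>

definition omega_law :: "nat \<Rightarrow> nat pmf" where
  "omega_law n = map_pmf omega (pmf_of_set {1..n})"

definition Omega_law :: "nat \<Rightarrow> nat pmf" where
  "Omega_law n = map_pmf Omega (pmf_of_set {1..n})"

definition Phi_hat_omega :: "complex \<Rightarrow> complex" where
  "Phi_hat_omega x =
     (\<Prod>p. if prime p then (1 + (x - 1) / of_nat p) * exp (- ((x - 1) / of_nat p)) else 1)"

text \<open>The next product has poles at the primes, the smallest one being 2.\<close>

definition Phi_hat_Omega :: "complex \<Rightarrow> complex" where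
  "Phi_hat_Omega x =
     (\<Prod>p. if prime p
           then (1 - 1 / of_nat p) / (1 - x / of_nat p) * exp (- ((x - 1) / of_nat p)) else 1)"

end

theory Submission
  imports Defs "HOL-Complex_Analysis.Complex_Analysis" "HOL-Real_Asymp.Real_Asymp"
begin

text \<open>Only the values at real \<open>x\<close> between 0 and 1 have to be computed. The limiting function is holomorphic, as
a locally uniform limit of holomorphic functions, and so is the asserted right-hand side; the identity
theorem extends an equality on \<open>(0,1)\<close> to the whole domain (\<open>limit_function_identification\<close>).

Fix \<open>0 < x < 1\<close> and let \<open>f k\<close> be \<open>x ^ omega k\<close> or \<open>x ^ Omega k\<close>. Mod-Poisson convergence at \<open>x\<close> says that
\<open>\<Sum>k\<le>n. f k\<close>, divided by \<open>n (ln n)^(x-1)\<close>, tends to \<open>C = exp (\<kappa> (x-1)) \<Phi> x\<close>. The Dirichlet series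
\<open>F(s) = \<Sum>k. f k k^(-s)\<close> is now evaluated near \<open>s = 1\<close> in two ways. Written as a Laplace transform of
the summatory function, it satisfies \<open>(s-1)^x F(s) \<rightarrow> Gamma x C\<close> (\<open>dirichlet_series_abelian\<close>); this is where
the Gamma factor comes from. Written as an Euler product, it is \<open>\<Prod>p. A(p^(-s))\<close> for a power series
\<open>A(t) = 1 + x t + O(t^2)\<close>, so that the product for \<open>F(s) / \<zeta>(s)^x\<close> converges uniformly down to \<open>s = 1\<close>.
Comparing the two, the product of \<open>A(1/p) (1 - 1/p)^x\<close> over all primes equals \<open>Gamma x C\<close>
(\<open>mean_value_euler_product\<close>).

Finally these products are matched with the independent models. In terms of \<open>E(z) = (1-z) exp z\<close> and
the entire function \<open>W(z) = \<Prod>p. E(z/p)\<close>, the models have limiting functions \<open>W(1-x)\<close> and \<open>W(1) / W(x)\<close>,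
while \<open>A(t) (1-t)^x\<close> is \<open>E((1-x) t) E(t)^(x-1)\<close> for \<open>\<omega>\<close> and \<open>E(t)^x / E(x t)\<close> for \<open>\<Omega>\<close>. In both cases the
product over primes is the limiting function of the model times \<open>W(1)^(x-1)\<close>. Hence the constant is
\<open>\<kappa>' = ln W(1) - \<kappa>\<close>, the same for \<open>\<omega>\<close> and \<open>\<Omega>\<close>.

For \<open>\<Omega>\<close> the domain has to avoid the pole at 2: on the whole plane the hypothesis is contradictory
(\<open>Omega_not_mod_poisson_on_UNIV\<close>), and the statement holds vacuously there.\<close>

section \<open>An Abelian theorem for Dirichlet series\<close>

text \<open>With \<open>s = 1 + 1/m\<close>, each \<open>k^(-s)\<close> becomes an exponential integral over a half-line that starts at
\<open>ln k / m\<close>. The variable is already rescaled by \<open>m\<close>, so that the weight \<open>exp (-v)\<close> of the Gamma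
integral splits off later without a change of variables.\<close>

lemma nn_integral_exp_tail:
  fixes k m :: nat
  assumes "m > 0" "k > 0"
  shows "(\<integral>\<^sup>+v. ennreal (indicator {ln k / m..} v * ((real m + 1) * exp (-(real m + 1) * v))) \<partial>lborel)
           = ennreal (real k powr -(1 + 1 / m))"
proof -
  have "((\<lambda>v. exp (-(real m + 1) * v)) has_integral exp (-(real m + 1) * (ln k / m)) / (real m + 1)) {ln k / m..}"
    by (rule has_integral_exp_minus_to_infinity) auto
  hence "((\<lambda>v. (real m + 1) * exp (-(real m + 1) * v)) has_integral
           (real m + 1) * (exp (-(real m + 1) * (ln k / m)) / (real m + 1))) {ln k / m..}"
    by (rule has_integral_mult_right)
  also have "(real m + 1) * (exp (-(real m + 1) * (ln k / m)) / (real m + 1)) = exp (-(real m + 1) * (ln k / m))"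
    by (simp add: field_simps)
  also have "-(real m + 1) * (ln k / m) = -(1 + 1 / m) * ln k"
    using assms by (simp add: field_simps)
  also have "exp (-(1 + 1 / m) * ln k) = real k powr -(1 + 1 / m)"
    using assms by (simp add: powr_def)
  finally have "((\<lambda>v. if v \<in> {ln k / m..} then (real m + 1) * exp (-(real m + 1) * v) else 0)
      has_integral real k powr -(1 + 1 / m)) UNIV"
    by (subst has_integral_restrict_UNIV)
  also have "(\<lambda>v. if v \<in> {ln k / m..} then (real m + 1) * exp (-(real m + 1) * v) else 0) =
       (\<lambda>v. indicator {ln k / m..} v * ((real m + 1) * exp (-(real m + 1) * v)))"
    by (auto simp: indicator_def)
  finally show ?thesis
    by (intro nn_integral_has_integral_lborel) auto
qed

text \<open>Summation by parts in integral form: by positivity, sum and integral may be exchanged in the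
previous formula, and at \<open>v\<close> exactly the indices \<open>k \<le> exp (m v)\<close> contribute.\<close>

lemma dirichlet_series_eq_laplace:
  fixes f :: "nat \<Rightarrow> real" and m :: nat
  assumes f: "\<And>k. 0 \<le> f k" "\<And>k. f k \<le> 1" and m: "m > 0"
  shows "summable (\<lambda>k. f k * real k powr -(1 + 1 / m))"
    and "ennreal (\<Sum>k. f k * real k powr -(1 + 1 / m)) =
       (\<integral>\<^sup>+v. ennreal (indicator {0<..} v * ((real m + 1) * exp (-(real m + 1) * v)) *
          (\<Sum>k=1..nat \<lfloor>exp (m * v)\<rfloor>. f k)) \<partial>lborel)"
proof -
  show sm: "summable (\<lambda>k. f k * real k powr -(1 + 1 / m))"
  proof (rule summable_comparison_test')
    show "summable (\<lambda>k. real k powr -(1 + 1 / m))"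
      using m by (subst summable_real_powr_iff) auto
    show "norm (f k * real k powr -(1 + 1 / m)) \<le> real k powr -(1 + 1 / m)" for k
      using f[of k] by (auto simp: abs_mult intro!: mult_left_le_one_le)
  qed
  define h where "h k v = f k * (indicator {ln (real k) / m..} v * ((real m + 1) * exp (-(real m + 1) * v)))"
    for k :: nat and v :: real
  have [measurable]: "h k \<in> borel_measurable lborel" for k unfolding h_def by measurable
  \<comment> \<open>The term at 0 vanishes since \<open>0 powr a = 0\<close>, whereas \<open>ln 0 = 0\<close> would put 0 among the indices.\<close>
  have term_eq: "ennreal (f k * real k powr -(1 + 1 / m)) =
      (\<integral>\<^sup>+v. (if k = 0 then 0 else ennreal (h k v)) \<partial>lborel)" for k
  proof (cases "k = 0")
    case False
    have "(\<integral>\<^sup>+v. ennreal (h k v) \<partial>lborel) = ennreal (f k) *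
       (\<integral>\<^sup>+v. ennreal (indicator {ln (real k) / m..} v * ((real m + 1) * exp (-(real m + 1) * v))) \<partial>lborel)"
      unfolding h_def using f by (subst nn_integral_cmult [symmetric]) (auto simp: ennreal_mult')
    thus ?thesis using False f nn_integral_exp_tail[of m k] m by (simp add: ennreal_mult')
  qed auto
  have "ennreal (\<Sum>k. f k * real k powr -(1 + 1 / m)) = (\<Sum>k. ennreal (f k * real k powr -(1 + 1 / m)))"
    using sm f by (intro suminf_ennreal2 [symmetric]) auto
  also have "\<dots> = (\<integral>\<^sup>+v. (\<Sum>k. if k = 0 then 0 else ennreal (h k v)) \<partial>lborel)"
    unfolding term_eq by (rule nn_integral_suminf [symmetric]) measurable
  also have "\<dots> = (\<integral>\<^sup>+v. ennreal (indicator {0<..} v * ((real m + 1) * exp (-(real m + 1) * v)) *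
          (\<Sum>k=1..nat \<lfloor>exp (m * v)\<rfloor>. f k)) \<partial>lborel)"
  proof (rule nn_integral_cong_AE, rule AE_mp[OF AE_lborel_singleton[of 0]], rule AE_I2, rule impI)
    fix v :: real assume "v \<noteq> 0"
    have mem: "k \<noteq> 0 \<and> ln (real k) / m \<le> v \<longleftrightarrow> k \<in> {1..nat \<lfloor>exp (m * v)\<rfloor>}" for k
    proof (cases "k = 0")
      case False
      have "ln (real k) / m \<le> v \<longleftrightarrow> ln (real k) \<le> m * v" using m by (simp add: field_simps)
      also have "\<dots> \<longleftrightarrow> real k \<le> exp (m * v)" using False by (metis exp_le_cancel_iff exp_ln of_nat_0_less_iff neq0_conv)
      also have "\<dots> \<longleftrightarrow> k \<le> nat \<lfloor>exp (m * v)\<rfloor>" by (metis le_nat_floor le_nat_iff floor_less_iff linorder_not_less of_int_of_nat_eq exp_ge_zero zero_le_floor le_floor_iff)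
      finally show ?thesis using False by auto
    qed auto
    have "(\<Sum>k. if k = 0 then 0 else ennreal (h k v)) =
          (\<Sum>k\<in>{1..nat \<lfloor>exp (m * v)\<rfloor>}. if k = 0 then 0 else ennreal (h k v))"
      using mem by (intro suminf_finite) (auto simp: h_def indicator_def)
    also have "\<dots> = (\<Sum>k\<in>{1..nat \<lfloor>exp (m * v)\<rfloor>}. ennreal (f k * ((real m + 1) * exp (-(real m + 1) * v))))"
      by (intro sum.cong refl) (use mem in \<open>auto simp: h_def indicator_def\<close>)
    also have "\<dots> = ennreal (\<Sum>k\<in>{1..nat \<lfloor>exp (m * v)\<rfloor>}. f k * ((real m + 1) * exp (-(real m + 1) * v)))"
      using f by (intro sum_ennreal) auto
    also have "(\<Sum>k\<in>{1..nat \<lfloor>exp (m * v)\<rfloor>}. f k * ((real m + 1) * exp (-(real m + 1) * v))) =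
        indicator {0<..} v * ((real m + 1) * exp (-(real m + 1) * v)) * (\<Sum>k=1..nat \<lfloor>exp (m * v)\<rfloor>. f k)"
    proof (cases "v > 0")
      case True
      thus ?thesis by (simp add: sum_distrib_left mult_ac)
    next
      case False
      hence "m * v < 0" using \<open>v \<noteq> 0\<close> m by (simp add: mult_less_0_iff)
      hence "exp (m * v) < 1" by simp
      hence "nat \<lfloor>exp (m * v)\<rfloor> = 0" by (simp add: floor_less_iff)
      thus ?thesis by simp
    qed
    finally show "(\<Sum>k. if k = 0 then 0 else ennreal (h k v)) = \<dots>" .
  qed
  finally show "ennreal (\<Sum>k. f k * real k powr -(1 + 1 / m)) = \<dots>" .
qed

lemma nat_floor_exp_asymp:
  defines "N \<equiv> \<lambda>u::real. nat \<lfloor>exp u\<rfloor>"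
  shows "filterlim N sequentially at_top"
    and "((\<lambda>u. real (N u) / exp u) \<longlongrightarrow> 1) at_top"
    and "((\<lambda>u. ln (real (N u)) / u) \<longlongrightarrow> 1) at_top"
proof -
  have N: "real (N u) = of_int \<lfloor>exp u\<rfloor>" for u by (simp add: N_def)
  show "((\<lambda>u. real (N u) / exp u) \<longlongrightarrow> 1) at_top" unfolding N by real_asymp
  show "((\<lambda>u. ln (real (N u)) / u) \<longlongrightarrow> 1) at_top" unfolding N by real_asymp
  have "filterlim (\<lambda>u. real (N u)) at_top at_top" unfolding N by real_asymp
  thus "filterlim N sequentially at_top"
    by (simp add: filterlim_sequentially_iff_filterlim_real)
qed

lemma Gamma_kernel_lborel:
  fixes x :: real
  assumes "x > 0"
  shows "has_bochner_integral lborel (\<lambda>v. indicator {0<..} v * (v powr (x - 1) * exp (-v))) (Gamma x)"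
proof -
  have "((\<lambda>t. t powr (x - 1) / exp t) has_integral Gamma x) {0<..}"
    using Gamma_integral_real[OF assms] 
    by (subst (asm) has_integral_spike_set_eq[of _ "{0<..}"])
       (auto intro: negligible_subset[of "{0}"])
  hence "((\<lambda>v. if v \<in> {0<..} then v powr (x - 1) / exp v else 0) has_integral Gamma x) UNIV"
    by (subst has_integral_restrict_UNIV)
  also have "(\<lambda>v. if v \<in> {0<..} then v powr (x - 1) / exp v else 0) = 
      (\<lambda>v. indicator {0<..} v * (v powr (x - 1) * exp (-v)))"
    by (auto simp: indicator_def exp_minus field_simps)
  finally have *: "((\<lambda>v. indicator {0<..} v * (v powr (x - 1) * exp (-v))) has_integral Gamma x) UNIV" .
  have "(\<integral>\<^sup>+v. ennreal (indicator {0<..} v * (v powr (x - 1) * exp (-v))) \<partial>lborel) = ennreal (Gamma x)"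
    by (rule nn_integral_has_integral_lborel[OF _ _ *]) auto
  thus ?thesis
    using assms by (intro has_bochner_integral_nn_integral) (auto intro!: Gamma_real_nonneg)
qed

text \<open>In the Laplace representation the normalised summatory function at \<open>exp (m v)\<close> tends to \<open>C\<close> for
every \<open>v > 0\<close> while the remaining kernel is \<open>v^(x-1) exp (-v)\<close>, whose integral is \<open>Gamma x\<close>;
dominated convergence exchanges limit and integral. The restriction \<open>x \<le> 1\<close> keeps the normalised
summatory function bounded near \<open>v = 0\<close>, so that a multiple of the kernel dominates.\<close>

lemma dirichlet_series_abelian:
  fixes f :: "nat \<Rightarrow> real" and x C :: real
  assumes f: "\<And>k. 0 \<le> f k" "\<And>k. f k \<le> 1" and x: "0 < x" "x \<le> 1"
    and lim: "(\<lambda>n. (\<Sum>k=1..n. f k) / (real n * ln (real n) powr (x - 1))) \<longlonglongrightarrow> C"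
  shows "(\<lambda>m. (\<Sum>k. f k * real k powr -(1 + 1 / real m)) * real m powr (-x)) \<longlonglongrightarrow> Gamma x * C"
proof -
  define S where "S n = (\<Sum>k=1..n. f k)" for n :: nat
  define N where "N u = nat \<lfloor>exp u\<rfloor>" for u :: real
  define g where "g u = S (N u) * exp (-u) * u powr (1 - x)" for u
  have S_nonneg: "S n \<ge> 0" for n using f by (auto simp: S_def intro!: sum_nonneg)
  have S_le: "S n \<le> n" for n
    using sum_bounded_above[of "{1..n}" f 1] f by (auto simp: S_def)
  have N_le: "real (N u) \<le> exp u" for u by (simp add: N_def)
  have g_lim: "(g \<longlongrightarrow> C) at_top"
  proof -
    have "((\<lambda>u. S (N u) / (real (N u) * ln (real (N u)) powr (x - 1)) * (real (N u) / exp u) *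
        (ln (real (N u)) / u) powr (x - 1)) \<longlongrightarrow> C * 1 * 1 powr (x - 1)) at_top"
      using filterlim_compose[OF lim nat_floor_exp_asymp(1)] nat_floor_exp_asymp(2,3)
      unfolding S_def N_def by (intro tendsto_intros) auto
    moreover have "eventually (\<lambda>u. S (N u) / (real (N u) * ln (real (N u)) powr (x - 1)) * (real (N u) / exp u) *
        (ln (real (N u)) / u) powr (x - 1) = g u) at_top"
      using eventually_gt_at_top[of "ln 2"]
    proof eventually_elim
      case (elim u)
      have u: "u > 0" using elim ln_gt_zero[of "2::real"] by linarith
      have "exp u > 2" using elim by (metis exp_less_mono exp_ln zero_less_numeral)
      hence "N u \<ge> 2" unfolding N_def by (simp add: le_nat_iff le_floor_iff)
      hence L: "ln (real (N u)) > 0" and N0: "N u > 0" by auto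
      have "(ln (real (N u)) / u) powr (x - 1) = ln (real (N u)) powr (x - 1) * u powr (1 - x)"
        using L u by (simp add: powr_divide powr_diff field_simps)
      thus ?case using L u N0 by (simp add: g_def exp_minus field_simps)
    qed
    ultimately show ?thesis by (simp add: Lim_transform_eventually)
  qed
  have g_nonneg: "g u \<ge> 0" for u by (auto simp: g_def S_nonneg)
  \<comment> \<open>Beyond some \<open>U\<close> the limit gives the bound; below it the trivial bound \<open>S n \<le> n\<close> suffices.\<close>
  obtain K where K: "\<And>u. u > 0 \<Longrightarrow> g u \<le> K"
  proof -
    have "eventually (\<lambda>u. g u < C + 1) at_top" using g_lim by (rule order_tendstoD) auto
    then obtain U where U: "\<And>u. u \<ge> U \<Longrightarrow> g u < C + 1" by (auto simp: eventually_at_top_linorder)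
    have "g u \<le> max (C + 1) (max U 1)" if "u > 0" for u
    proof (cases "u \<ge> U")
      case True thus ?thesis using U[of u] by auto
    next
      case False
      have "S (N u) * exp (-u) \<le> exp u * exp (-u)"
        by (intro mult_right_mono order.trans[OF S_le N_le]) auto
      also have "\<dots> = 1" by (simp add: exp_minus)
      finally have "g u \<le> 1 * u powr (1 - x)" unfolding g_def by (intro mult_right_mono) auto
      also have "\<dots> \<le> (max U 1) powr (1 - x)" using False that x by (auto intro!: powr_mono2)
      also have "\<dots> \<le> max U 1 powr 1" using x by (intro powr_mono) auto
      finally show ?thesis by simp
    qed
    thus ?thesis using that by blast
  qed
  define h where "h m v = indicator {0<..} v * (g (real m * v) * (v powr (x - 1) * exp (-v)))"
    for m :: nat and v :: real
  have [measurable]: "g \<in> borel_measurable borel" unfolding g_def N_def by measurable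
  have ker: "integrable lborel (\<lambda>v. K * (indicator {0<..} v * (v powr (x - 1) * exp (-v))))"
    using Gamma_kernel_lborel[OF x(1)] by (intro integrable_mult_right) (auto simp: has_bochner_integral_iff)
  have h_bound: "norm (h m v) \<le> K * (indicator {0<..} v * (v powr (x - 1) * exp (-v)))" if "m > 0" for m v
    using K[of "real m * v"] g_nonneg[of "real m * v"] that
    by (auto simp: h_def indicator_def abs_mult intro!: mult_right_mono)
  have h_meas: "h m \<in> borel_measurable lborel" for m unfolding h_def by measurable
  have h_int: "integrable lborel (h m)" if "m > 0" for m
  proof (rule Bochner_Integration.integrable_bound[OF ker h_meas])
    show "AE v in lborel. norm (h m v) \<le> norm (K * (indicator {0<..} v * (v powr (x - 1) * exp (-v))))"
      by (rule AE_I2, rule order.trans[OF h_bound[OF that] abs_ge_self[of "K * _", folded real_norm_def]])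
  qed
  have "(\<lambda>m. integral\<^sup>L lborel (h (Suc m))) \<longlonglongrightarrow>
          integral\<^sup>L lborel (\<lambda>v. C * (indicator {0<..} v * (v powr (x - 1) * exp (-v))))"
  proof (rule integral_dominated_convergence[OF _ _ ker])
    show "AE v in lborel. norm (h (Suc m) v) \<le> K * (indicator {0<..} v * (v powr (x - 1) * exp (-v)))" for m
      by (rule AE_I2, rule h_bound) auto
    have "(\<lambda>m. h (Suc m) v) \<longlonglongrightarrow> C * (indicator {0<..} v * (v powr (x - 1) * exp (-v)))" for v
    proof (cases "v > 0")
      case True
      have "filterlim (\<lambda>m. real (Suc m) * v) at_top sequentially"
        using True by real_asymp
      from filterlim_compose[OF g_lim this]
      have "(\<lambda>m. indicator {0<..} v * (g (real (Suc m) * v) * (v powr (x - 1) * exp (-v)))) \<longlonglongrightarrow> 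
         indicator {0<..} v * (C * (v powr (x - 1) * exp (-v)))"
        by (intro tendsto_intros)
      thus ?thesis by (simp add: h_def mult_ac)
    qed (auto simp: h_def)
    thus "AE v in lborel. (\<lambda>m. h (Suc m) v) \<longlonglongrightarrow> C * (indicator {0<..} v * (v powr (x - 1) * exp (-v)))"
      by (intro AE_I2)
  qed (use h_meas in auto)
  also have "integral\<^sup>L lborel (\<lambda>v. C * (indicator {0<..} v * (v powr (x - 1) * exp (-v)))) = C * Gamma x"
    using Gamma_kernel_lborel[OF x(1)] by (simp add: has_bochner_integral_iff)
  finally have lim_int: "(\<lambda>m. integral\<^sup>L lborel (h m)) \<longlonglongrightarrow> C * Gamma x"
    by (subst (asm) filterlim_sequentially_Suc)
  have "eventually (\<lambda>m. (1 + 1 / real m) * integral\<^sup>L lborel (h m) =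
      (\<Sum>k. f k * real k powr -(1 + 1 / real m)) * real m powr (-x)) sequentially"
    using eventually_gt_at_top[of 0]
  proof eventually_elim
    case (elim m)
    have *: "(\<Sum>k. f k * real k powr -(1 + 1 / real m)) \<ge> 0"
      using dirichlet_series_eq_laplace(1)[OF f elim] f by (intro suminf_nonneg) auto
    have "ennreal ((\<Sum>k. f k * real k powr -(1 + 1 / real m)) * real m powr (-x)) =
       (\<integral>\<^sup>+v. ennreal (indicator {0<..} v * ((real m + 1) * exp (-(real m + 1) * v)) * S (N (m * v))) *
           ennreal (real m powr (-x)) \<partial>lborel)"
      unfolding ennreal_mult[OF * powr_ge_zero] S_def N_def dirichlet_series_eq_laplace(2)[OF f elim]
      by (rule nn_integral_multc [symmetric]) measurable
    also have "\<dots> = (\<integral>\<^sup>+v. ennreal ((1 + 1 / real m) * h m v) \<partial>lborel)"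
    proof (rule nn_integral_cong)
      fix v :: real
      have "indicator {0<..} v * ((real m + 1) * exp (-(real m + 1) * v)) * S (N (m * v)) * real m powr (-x) =
         (1 + 1 / real m) * h m v"
      proof (cases "v > 0")
        case True
        \<comment> \<open>The powers of \<open>v\<close> cancel, and those of \<open>m\<close> combine to the normalising factor \<open>m^(-x)\<close>.\<close>
        have "(1 + 1 / real m) * (real m * v) powr (1 - x) * v powr (x - 1) =
           (1 + 1 / real m) * real m powr 1 * real m powr (-x) * (v powr (1 - x) * v powr (x - 1))"
          using True elim by (simp add: powr_mult powr_diff powr_minus field_simps)
        also have "v powr (1 - x) * v powr (x - 1) = 1" using True by (simp add: powr_add [symmetric])
        also have "(1 + 1 / real m) * real m powr 1 = real m + 1" using elim by (simp add: field_simps)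
        finally have 1: "(1 + 1 / real m) * (real m * v) powr (1 - x) * v powr (x - 1) = (real m + 1) * real m powr (-x)"
          by simp
        have 2: "exp (-(real m + 1) * v) = exp (- (real m * v)) * exp (-v)"
          by (simp add: exp_add [symmetric] algebra_simps)
        have "(1 + 1 / real m) * h m v = ((1 + 1 / real m) * (real m * v) powr (1 - x) * v powr (x - 1)) *
            (S (N (m * v)) * (exp (- (real m * v)) * exp (-v)))"
          using True by (simp add: h_def g_def)
        also have "\<dots> = ((real m + 1) * real m powr (-x)) * (S (N (m * v)) * exp (-(real m + 1) * v))"
          unfolding 1 2 ..
        finally show ?thesis using True by simp
      qed (auto simp: h_def)
      thus "ennreal (indicator {0<..} v * ((real m + 1) * exp (-(real m + 1) * v)) * S (N (m * v))) *
           ennreal (real m powr (-x)) = ennreal ((1 + 1 / real m) * h m v)"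
        by (metis ennreal_mult'' powr_ge_zero)
    qed
    also have "\<dots> = ennreal (\<integral>v. (1 + 1 / real m) * h m v \<partial>lborel)"
      using g_nonneg by (intro nn_integral_eq_integral integrable_mult_right h_int[OF elim] AE_I2)
        (auto simp: h_def indicator_def)
    also have "(\<integral>v. (1 + 1 / real m) * h m v \<partial>lborel) = (1 + 1 / real m) * integral\<^sup>L lborel (h m)"
      by (rule integral_mult_right_zero)
    finally show ?case using * g_nonneg
      by (subst (asm) ennreal_inj) (auto simp: h_def intro!: mult_nonneg_nonneg integral_nonneg_AE AE_I2)
  qed
  moreover have "(\<lambda>m. (1 + 1 / real m) * integral\<^sup>L lborel (h m)) \<longlonglongrightarrow> (1 + 0) * (C * Gamma x)"
    by (intro tendsto_intros lim_int)
  ultimately show ?thesis by (simp add: Lim_transform_eventually mult.commute)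
qed

section \<open>Euler products of nonnegative multiplicative functions\<close>

definition smooth_numbers :: "nat set \<Rightarrow> nat set" where
  "smooth_numbers A = {n. n > 0 \<and> prime_factors n \<subseteq> A}"

text \<open>Adding one prime to the base splits off the exact power of that prime; this is the inductive step
behind finite Euler products.\<close>

lemma bij_betw_smooth_numbers_insert:
  assumes "prime q" "q \<notin> A"
  shows "bij_betw (\<lambda>(n, j). n * q ^ j) (smooth_numbers A \<times> UNIV) (smooth_numbers (insert q A))"
proof (rule bij_betw_byWitness[where f' = "\<lambda>n. (n div q ^ multiplicity q n, multiplicity q n)"])
  have not_dvd: "\<not> q dvd n" if "n \<in> smooth_numbers A" for n
    using that assms by (auto simp: smooth_numbers_def prime_factors_dvd)
  have "multiplicity q (n * q ^ j) = j" if "n \<in> smooth_numbers A" for n j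
    using not_dvd[OF that] that assms
    by (subst prime_elem_multiplicity_mult_distrib)
       (auto simp: smooth_numbers_def not_dvd_imp_multiplicity_0 multiplicity_same_power)
  thus "\<forall>a\<in>smooth_numbers A \<times> UNIV. (case (case a of (n, j) \<Rightarrow> n * q ^ j) of
      n \<Rightarrow> (n div q ^ multiplicity q n, multiplicity q n)) = a"
    using assms by (auto simp: prime_gt_0_nat)
  show "\<forall>n\<in>smooth_numbers (insert q A). (case (n div q ^ multiplicity q n, multiplicity q n) of
      (n, j) \<Rightarrow> n * q ^ j) = n"
    by (auto simp: multiplicity_dvd)
  show "(\<lambda>(n, j). n * q ^ j) ` (smooth_numbers A \<times> UNIV) \<subseteq> smooth_numbers (insert q A)"
    using assms by (auto simp: smooth_numbers_def prime_factors_product prime_gt_0_nat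
        prime_factorization_prime_power split: if_splits)
  show "(\<lambda>n. (n div q ^ multiplicity q n, multiplicity q n)) ` smooth_numbers (insert q A)
          \<subseteq> smooth_numbers A \<times> UNIV"
  proof safe
    fix n assume n: "n \<in> smooth_numbers (insert q A)"
    define m where "m = n div q ^ multiplicity q n"
    have nm: "n = m * q ^ multiplicity q n" by (simp add: m_def multiplicity_dvd)
    have "n > 0" using n by (auto simp: smooth_numbers_def)
    hence "m > 0" using nm by (cases "m = 0") auto
    have "\<not> q dvd m" unfolding m_def
      using \<open>n > 0\<close> assms by (intro multiplicity_decompose) auto
    moreover have "prime_factors m \<subseteq> insert q A"
      using n nm \<open>n > 0\<close> by (metis (no_types, lifting) dvd_prime_factors dvd_triv_left mem_Collect_eq 
         smooth_numbers_def subset_trans neq0_conv)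
    ultimately show "m \<in> smooth_numbers A" using \<open>m > 0\<close>
      by (auto simp: smooth_numbers_def prime_factors_dvd)
  qed auto
qed

lemma has_sum_smooth_numbers:
  fixes g :: "nat \<Rightarrow> real"
  assumes g1: "g 1 = 1" and g_nonneg: "\<And>n. g n \<ge> 0"
    and g_mult: "\<And>m n. coprime m n \<Longrightarrow> g (m * n) = g m * g n"
    and A: "finite A" "\<And>p. p \<in> A \<Longrightarrow> prime p"
    and E: "\<And>p. prime p \<Longrightarrow> (\<lambda>j. g (p ^ j)) sums E p"
  shows "(g has_sum (\<Prod>p\<in>A. E p)) (smooth_numbers A)"
  using A
proof (induction A rule: finite_induct)
  case empty
  have "smooth_numbers {} = {1}"
    by (auto simp: smooth_numbers_def prime_factorization_empty_iff)
  thus ?case using g1 has_sum_finite[of "{1}" g] by simp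
next
  case (insert q A)
  have q: "prime q" using insert.prems by auto
  have IH: "(g has_sum (\<Prod>p\<in>A. E p)) (smooth_numbers A)" using insert by auto
  have Eq: "((\<lambda>j. g (q ^ j)) has_sum E q) UNIV"
    by (intro sums_nonneg_imp_has_sum E q g_nonneg)
  have "((\<lambda>(n, j). g n * g (q ^ j)) has_sum (\<Prod>p\<in>A. E p) * E q) (smooth_numbers A \<times> UNIV)"
  proof (rule has_sum_SigmaI)
    show "((\<lambda>j. case (n, j) of (n, j) \<Rightarrow> g n * g (q ^ j)) has_sum g n * E q) UNIV" for n
      using has_sum_cmult_right[OF Eq, of "g n"] by simp
    show "((\<lambda>n. g n * E q) has_sum (\<Prod>p\<in>A. E p) * E q) (smooth_numbers A)"
      by (rule has_sum_cmult_left[OF IH])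
    show "(\<lambda>(n, j). g n * g (q ^ j)) summable_on smooth_numbers A \<times> UNIV"
    proof (rule summable_on_SigmaI[where g = "\<lambda>n. g n * E q"])
      show "((\<lambda>j. case (n, j) of (n, j) \<Rightarrow> g n * g (q ^ j)) has_sum g n * E q) UNIV" for n
        using has_sum_cmult_right[OF Eq, of "g n"] by simp
      show "(\<lambda>n. g n * E q) summable_on smooth_numbers A"
        using has_sum_cmult_left[OF IH] by (rule has_sum_imp_summable)
    qed (auto simp: g_nonneg)
  qed
  also have "?this \<longleftrightarrow> ((\<lambda>z. g (case z of (n, j) \<Rightarrow> n * q ^ j)) has_sum (\<Prod>p\<in>A. E p) * E q) 
      (smooth_numbers A \<times> UNIV)"
  proof (rule has_sum_cong)
    fix z assume "z \<in> smooth_numbers A \<times> (UNIV :: nat set)"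
    then obtain n j where z: "z = (n, j)" and n: "n \<in> smooth_numbers A" by auto
    have "\<not> q dvd n" using n q insert.hyps by (auto simp: smooth_numbers_def prime_factors_dvd)
    hence "coprime n (q ^ j)" using q by (metis coprime_commute coprime_power_right_iff prime_imp_coprime)
    thus "(case z of (n, j) \<Rightarrow> g n * g (q ^ j)) = g (case z of (n, j) \<Rightarrow> n * q ^ j)"
      by (simp add: z g_mult)
  qed
  also have "\<dots> \<longleftrightarrow> (g has_sum (\<Prod>p\<in>A. E p) * E q) (smooth_numbers (insert q A))"
    by (rule has_sum_reindex_bij_betw[OF bij_betw_smooth_numbers_insert[OF q insert.hyps(2)]])
  finally show ?case using insert.hyps by (simp add: mult.commute)
qed

text \<open>The finite product over the primes up to \<open>N\<close> sums \<open>g\<close> over a set of integers containing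
\<open>1, \<dots>, N\<close>. As \<open>g \<ge> 0\<close>, it is squeezed between a partial sum and the full series.\<close>

lemma euler_product_LIMSEQ:
  fixes g :: "nat \<Rightarrow> real"
  assumes g0: "g 0 = 0" and g1: "g 1 = 1" and g_nonneg: "\<And>n. g n \<ge> 0"
    and g_mult: "\<And>m n. coprime m n \<Longrightarrow> g (m * n) = g m * g n"
    and E: "\<And>p. prime p \<Longrightarrow> (\<lambda>j. g (p ^ j)) sums E p"
    and sm: "summable g"
  shows "(\<lambda>N. \<Prod>p | prime p \<and> p \<le> N. E p) \<longlonglongrightarrow> (\<Sum>n. g n)"
proof (rule tendsto_sandwich)
  define P where "P N = {p. prime p \<and> p \<le> (N::nat)}" for N
  have hs: "(g has_sum (\<Prod>p\<in>P N. E p)) (smooth_numbers (P N))" for N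
    by (intro has_sum_smooth_numbers assms) (auto simp: P_def)
  have "(g has_sum (\<Sum>n. g n)) UNIV"
    using sm g_nonneg by (intro sums_nonneg_imp_has_sum summable_sums)
  hence "(\<Prod>p\<in>P N. E p) \<le> (\<Sum>n. g n)" for N
    using g_nonneg by (intro has_sum_mono_neutral[OF hs]) auto
  thus "eventually (\<lambda>N. (\<Prod>p | prime p \<and> p \<le> N. E p) \<le> (\<Sum>n. g n)) sequentially"
    by (auto simp: P_def)
  have "(\<Sum>n\<le>N. g n) \<le> (\<Prod>p\<in>P N. E p)" for N
  proof -
    have fin: "(g has_sum sum g {1..N}) {1..N}" by (rule has_sum_finite) auto
    have "n \<in> smooth_numbers (P N)" if "n \<in> {1..N}" for n
      using that by (auto simp: smooth_numbers_def P_def prime_factors_dvd intro: order.trans[OF dvd_imp_le])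
    hence "sum g {1..N} \<le> (\<Prod>p\<in>P N. E p)"
      using g_nonneg by (intro has_sum_mono_neutral[OF fin hs]) auto
    also have "sum g {1..N} = (\<Sum>n\<le>N. g n)"
      using g0 by (intro sum.mono_neutral_left) (auto simp: not_less_eq_eq Suc_le_eq)
    finally show ?thesis .
  qed
  thus "eventually (\<lambda>N. (\<Sum>n\<le>N. g n) \<le> (\<Prod>p | prime p \<and> p \<le> N. E p)) sequentially"
    by (auto simp: P_def)
  show "(\<lambda>N. \<Sum>n\<le>N. g n) \<longlonglongrightarrow> (\<Sum>n. g n)" using sm by (rule summable_LIMSEQ')
qed auto

section \<open>Mean values and Euler products\<close>

text \<open>The multiplicative functions that occur here take the same value \<open>a j\<close> at the \<open>j\<close>-th power of every
prime. Their local Euler factor at \<open>p\<close> is then one and the same power series, with coefficients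
\<open>a j\<close>, evaluated at \<open>p^(-s)\<close>.\<close>

definition mult_ext :: "(nat \<Rightarrow> real) \<Rightarrow> nat \<Rightarrow> real" where
  "mult_ext a n = (\<Prod>p\<in>prime_factors n. a (multiplicity p n))"

lemma mult_ext_1 [simp]: "mult_ext a 1 = 1" "mult_ext a (Suc 0) = 1"
  by (simp_all add: mult_ext_def)

lemma mult_ext_bounds:
  assumes "\<And>j. 0 \<le> a j" "\<And>j. a j \<le> 1"
  shows "0 \<le> mult_ext a n" "mult_ext a n \<le> 1"
  unfolding mult_ext_def using assms by (auto intro!: prod_nonneg prod_le_1)

lemma mult_ext_prime_power:
  assumes "prime p" "a 0 = 1"
  shows "mult_ext a (p ^ j) = a j"
  using assms by (cases "j = 0")
    (auto simp: mult_ext_def prime_factorization_prime_power multiplicity_same_power)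

lemma mult_ext_coprime_mult:
  assumes "coprime m n"
  shows "mult_ext a (m * n) = mult_ext a m * mult_ext a n"
proof (cases "m = 0 \<or> n = 0")
  case True
  thus ?thesis using assms by auto
next
  case False
  have disj: "prime_factors m \<inter> prime_factors n = {}"
    using assms False by (auto simp: prime_factors_dvd dest: coprime_common_divisor_nat)
  have "mult_ext a (m * n) = (\<Prod>p\<in>prime_factors m \<union> prime_factors n. a (multiplicity p (m * n)))"
    using False by (simp add: mult_ext_def prime_factors_product)
  also have "\<dots> = (\<Prod>p\<in>prime_factors m. a (multiplicity p (m * n))) * (\<Prod>p\<in>prime_factors n. a (multiplicity p (m * n)))"
    by (rule prod.union_disjoint) (use disj in auto)
  also have "(\<Prod>p\<in>prime_factors m. a (multiplicity p (m * n))) = mult_ext a m"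
    unfolding mult_ext_def
  proof (rule prod.cong[OF refl])
    fix p assume p: "p \<in> prime_factors m"
    hence "\<not> p dvd n" using disj False by (auto simp: prime_factors_dvd)
    thus "a (multiplicity p (m * n)) = a (multiplicity p m)" using p False
      by (subst prime_elem_multiplicity_mult_distrib)
         (auto simp: prime_factors_dvd not_dvd_imp_multiplicity_0)
  qed
  also have "(\<Prod>p\<in>prime_factors n. a (multiplicity p (m * n))) = mult_ext a n"
    unfolding mult_ext_def
  proof (rule prod.cong[OF refl])
    fix p assume p: "p \<in> prime_factors n"
    hence "\<not> p dvd m" using disj False by (auto simp: prime_factors_dvd)
    thus "a (multiplicity p (m * n)) = a (multiplicity p n)" using p False
      by (subst prime_elem_multiplicity_mult_distrib)
         (auto simp: prime_factors_dvd not_dvd_imp_multiplicity_0)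
  qed
  finally show ?thesis .
qed

lemma local_series_summable:
  fixes a :: "nat \<Rightarrow> real"
  assumes "\<And>j. 0 \<le> a j" "\<And>j. a j \<le> 1" "0 \<le> t" "t < 1"
  shows "summable (\<lambda>j. a j * t ^ j)"
proof (rule summable_comparison_test')
  show "summable (\<lambda>j. t ^ j)" using assms by (intro summable_geometric) auto
  show "norm (a j * t ^ j) \<le> t ^ j" for j
    using assms by (auto simp: abs_mult intro!: mult_left_le_one_le)
qed

lemma local_series_ge_1:
  fixes a :: "nat \<Rightarrow> real"
  assumes "\<And>j. 0 \<le> a j" "\<And>j. a j \<le> 1" "a 0 = 1" "0 \<le> t" "t < 1"
  shows "(\<Sum>j. a j * t ^ j) \<ge> 1"
  using sum_le_suminf[OF local_series_summable[of a t], of "{0}"] assms by auto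

text \<open>The factor \<open>(1 - t)^(a 1)\<close> cancels the linear term of the power series. The quadratic error makes the
logarithms summable over \<open>t = p^(-s)\<close>, uniformly down to \<open>s = 1\<close>.\<close>

lemma local_log_bound:
  fixes a :: "nat \<Rightarrow> real"
  assumes a: "\<And>j. 0 \<le> a j" "\<And>j. a j \<le> 1" "a 0 = 1" and t: "0 \<le> t" "t \<le> 1 / 2"
  shows "\<bar>ln (\<Sum>j. a j * t ^ j) + a 1 * ln (1 - t)\<bar> \<le> 8 * t\<^sup>2"
proof -
  have sm: "summable (\<lambda>j. a j * t ^ j)"
    using a t by (intro local_series_summable) auto
  define R where "R = (\<Sum>j. a (j + 2) * t ^ (j + 2))"
  have A: "(\<Sum>j. a j * t ^ j) = 1 + a 1 * t + R"
    using suminf_split_initial_segment[OF sm, of 2] a by (simp add: R_def eval_nat_numeral)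
  have sm2: "summable (\<lambda>j. a (j + 2) * t ^ (j + 2))"
    using sm by (rule summable_ignore_initial_segment)
  have R0: "R \<ge> 0" unfolding R_def using a t by (intro suminf_nonneg sm2) auto
  have geo: "(\<lambda>j. t ^ 2 * t ^ j) sums (t ^ 2 * (1 / (1 - t)))"
    using t by (intro sums_mult geometric_sums) auto
  have "R \<le> (\<Sum>j. t ^ 2 * t ^ j)"
    unfolding R_def
  proof (rule suminf_le[OF _ sm2])
    show "a (j + 2) * t ^ (j + 2) \<le> t ^ 2 * t ^ j" for j
      using mult_right_mono[OF a(2)[of "j + 2"], of "t ^ (j + 2)"] t by (simp add: power2_eq_square mult_ac)
  qed (use geo in \<open>simp add: sums_iff\<close>)
  also have "\<dots> = t ^ 2 * (1 / (1 - t))" using geo by (simp add: sums_iff)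
  also have "\<dots> \<le> t ^ 2 * 2" using t by (intro mult_left_mono) (auto simp: field_simps)
  finally have R: "R \<le> 2 * t\<^sup>2" by simp
  have t2: "t\<^sup>2 \<le> t / 2" using t mult_left_mono[of t "1/2" t] by (simp add: power2_eq_square)
  define u where "u = a 1 * t + R"
  have a1t: "0 \<le> a 1 * t" "a 1 * t \<le> t" using a(1,2)[of 1] t by (auto intro: mult_left_le_one_le)
  have u: "0 \<le> u" "u \<le> 2 * t" using a1t R0 R t2 by (auto simp: u_def)
  have "u ^ 2 \<le> (2 * t) ^ 2" using u by (intro power_mono) auto
  moreover have "\<bar>ln (1 + u) - u\<bar> \<le> u\<^sup>2"
    using u t by (intro abs_ln_one_plus_x_minus_x_bound_nonneg) auto
  ultimately have 1: "\<bar>ln (1 + u) - u\<bar> \<le> 4 * t\<^sup>2" by (simp add: power_mult_distrib)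
  have "\<bar>ln (1 + (-t)) - (-t)\<bar> \<le> 2 * (-t)\<^sup>2"
    using t by (intro abs_ln_one_plus_x_minus_x_bound) auto
  hence "a 1 * \<bar>ln (1 - t) + t\<bar> \<le> 1 * (2 * t\<^sup>2)"
    using a(1,2)[of 1] by (intro mult_mono) auto
  moreover have "a 1 * \<bar>ln (1 - t) + t\<bar> = \<bar>a 1 * ln (1 - t) + a 1 * t\<bar>"
    using a(1)[of 1] abs_mult[of "a 1" "ln (1 - t) + t"] by (simp add: distrib_left)
  ultimately have 2: "\<bar>a 1 * ln (1 - t) + a 1 * t\<bar> \<le> 2 * t\<^sup>2" by simp
  \<comment> \<open>The constant 8 is 4 + 2 + 2: errors of the two logarithms and the tail \<open>R\<close> of the series.\<close>
  show ?thesis using 1 2 R R0 unfolding A u_def by (simp add: add.assoc)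
qed

lemma dirichlet_series_euler_product:
  fixes a :: "nat \<Rightarrow> real"
  assumes a: "\<And>j. 0 \<le> a j" "\<And>j. a j \<le> 1" "a 0 = 1" and m: "m > (0 :: nat)"
  shows "(\<lambda>N. \<Prod>p | prime p \<and> p \<le> N. \<Sum>j. a j * (real p powr -(1 + 1 / real m)) ^ j)
           \<longlonglongrightarrow> (\<Sum>k. mult_ext a k * real k powr -(1 + 1 / real m))"
    and "(\<Sum>k. mult_ext a k * real k powr -(1 + 1 / real m)) \<ge> 1"
proof -
  define s where "s = 1 + 1 / real m"
  have s: "s > 1" using m by (simp add: s_def)
  define g where "g k = mult_ext a k * real k powr (-s)" for k
  note bounds = mult_ext_bounds[of a, OF a(1,2)]
  have sm: "summable g" unfolding g_def s_def
    by (rule dirichlet_series_eq_laplace(1)[OF bounds m])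
  have nonneg: "g n \<ge> 0" for n using bounds by (simp add: g_def)
  have "(\<lambda>N. \<Prod>p | prime p \<and> p \<le> N. \<Sum>j. a j * (real p powr (-s)) ^ j) \<longlonglongrightarrow> (\<Sum>k. g k)"
  proof (rule euler_product_LIMSEQ)
    fix p :: nat assume p: "prime p"
    have "(\<lambda>j. a j * (real p powr (-s)) ^ j) sums (\<Sum>j. a j * (real p powr (-s)) ^ j)"
    proof (intro summable_sums local_series_summable a)
      have "real p powr (-s) < real p powr 0"
        using s prime_gt_1_nat[OF p] by (intro powr_less_mono) auto
      thus "real p powr (-s) < 1" using prime_gt_1_nat[OF p] by simp
    qed auto
    moreover have "(\<lambda>j. a j * (real p powr (-s)) ^ j) = (\<lambda>j. g (p ^ j))"
      using prime_gt_0_nat[OF p] p a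
      by (auto simp: g_def mult_ext_prime_power powr_powr powr_realpow [symmetric] mult_ac)
    ultimately show "(\<lambda>j. g (p ^ j)) sums (\<Sum>j. a j * (real p powr (-s)) ^ j)" by simp
  qed (use sm nonneg in \<open>simp_all add: g_def [abs_def] mult_ext_coprime_mult powr_mult\<close>)
  thus "(\<lambda>N. \<Prod>p | prime p \<and> p \<le> N. \<Sum>j. a j * (real p powr -(1 + 1 / real m)) ^ j)
           \<longlonglongrightarrow> (\<Sum>k. mult_ext a k * real k powr -(1 + 1 / real m))"
    by (simp only: g_def s_def)
  have "sum g {1} \<le> (\<Sum>k. g k)" by (intro sum_le_suminf sm) (auto simp: nonneg)
  thus "(\<Sum>k. mult_ext a k * real k powr -(1 + 1 / real m)) \<ge> 1"
    by (simp add: g_def s_def)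
qed

lemma sum_primes_le:
  fixes b :: "nat \<Rightarrow> 'a :: comm_monoid_add"
  shows "(\<Sum>k\<le>N. if prime k then b k else 0) = (\<Sum>p | prime p \<and> p \<le> N. b p)"
  by (subst sum.inter_filter [symmetric]) (auto intro!: sum.cong)

text \<open>Both sides are the limit of \<open>(s - 1)^x F(s)\<close> as \<open>s\<close> decreases to 1 along \<open>1 + 1/m\<close>, where \<open>F\<close> is the
Dirichlet series, \<open>x = a 1\<close>, and \<open>A\<close> is the local series. The left-hand side comes from
\<open>F = \<zeta>^x exp (\<Sum>p. L (p^(-s)))\<close> with \<open>L(t) = ln A(t) + x ln (1 - t)\<close>, using Tannery's theorem for the sum
over primes, which the quadratic bound on \<open>L\<close> permits; the right-hand side comes from the
Abelian lemma. The fact \<open>(s - 1) \<zeta>(s) \<rightarrow> 1\<close> is the Abelian lemma for the constant function 1.\<close>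

lemma mean_value_euler_product:
  fixes a :: "nat \<Rightarrow> real" and C :: real
  assumes a: "\<And>j. 0 \<le> a j" "\<And>j. a j \<le> 1" "a 0 = 1" and x: "a 1 > 0"
    and lim: "(\<lambda>n. (\<Sum>k=1..n. mult_ext a k) / (real n * ln (real n) powr (a 1 - 1))) \<longlonglongrightarrow> C"
  shows "(\<lambda>N. \<Prod>p | prime p \<and> p \<le> N. (\<Sum>j. a j * (1 / real p) ^ j) * (1 - 1 / real p) powr a 1)
           \<longlonglongrightarrow> Gamma (a 1) * C"
proof -
  define x where "x = a 1"
  define A where "A t = (\<Sum>j. a j * t ^ j)" for t
  define L where "L t = ln (A t) + x * ln (1 - t)" for t
  define q where "q m p = real p powr -(1 + 1 / real m)" for m p :: nat
  define F where "F m = (\<Sum>k. mult_ext a k * real k powr -(1 + 1 / real m))" for m :: nat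
  define Z where "Z m = (\<Sum>k. mult_ext (\<lambda>_. 1) k * real k powr -(1 + 1 / real m))" for m :: nat
  define b where "b k m = (if prime k then L (q m k) else 0)" for k m
  define b' where "b' k = (if prime k then L (1 / real k) else 0)" for k :: nat
  have q: "0 \<le> q m p" "q m p \<le> 1 / real p" "q m p \<le> 1 / 2" if "prime p" for m p
  proof -
    have p2: "p \<ge> 2" using prime_ge_2_nat[OF that] .
    show "0 \<le> q m p" by (simp add: q_def)
    have "q m p \<le> real p powr (-1)" unfolding q_def using p2 by (intro powr_mono) auto
    thus le: "q m p \<le> 1 / real p" using p2 by (simp add: powr_minus_divide)
    have "1 / real p \<le> 1 / 2" using p2 by (intro divide_left_mono) auto
    with le show "q m p \<le> 1 / 2" by linarith
  qed
  have exp_L: "exp (L t) = A t * (1 - t) powr x" if "0 \<le> t" "t \<le> 1 / 2" for t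
    using local_series_ge_1[of a t] a that by (simp add: L_def exp_add powr_def A_def)
  have F_lim: "(\<lambda>m. F m * real m powr (-x)) \<longlonglongrightarrow> Gamma x * C"
    unfolding F_def x_def
    by (intro dirichlet_series_abelian mult_ext_bounds a lim assms)
  have Z_lim: "(\<lambda>m. Z m * real m powr (-1)) \<longlonglongrightarrow> 1"
  proof -
    have "(\<lambda>n. (\<Sum>k=1..n. mult_ext (\<lambda>_. 1) k) / (real n * ln (real n) powr (1 - 1))) \<longlonglongrightarrow> 1"
    proof (rule tendsto_eventually)
      show "eventually (\<lambda>n. (\<Sum>k=1..n. mult_ext (\<lambda>_. 1) k) / (real n * ln (real n) powr (1 - 1)) = 1) sequentially"
        using eventually_gt_at_top[of 1] by eventually_elim (simp add: mult_ext_def)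
    qed
    hence "(\<lambda>m. (\<Sum>k. mult_ext (\<lambda>_. 1) k * real k powr -(1 + 1 / real m)) * real m powr (-1)) \<longlonglongrightarrow> Gamma 1 * 1"
      by (intro dirichlet_series_abelian) (auto intro: mult_ext_bounds)
    thus ?thesis unfolding Z_def by simp
  qed
  have F_prod: "(\<lambda>N. \<Prod>p | prime p \<and> p \<le> N. A (q m p)) \<longlonglongrightarrow> F m" if "m > 0" for m
    unfolding A_def q_def F_def by (intro dirichlet_series_euler_product a that)
  have Z_prod: "(\<lambda>N. \<Prod>p | prime p \<and> p \<le> N. 1 / (1 - q m p)) \<longlonglongrightarrow> Z m" and Z_ge: "Z m \<ge> 1" if "m > 0" for m
  proof -
    have "(\<lambda>N. \<Prod>p | prime p \<and> p \<le> N. \<Sum>j. 1 * q m p ^ j) \<longlonglongrightarrow> Z m"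
      unfolding q_def Z_def by (intro dirichlet_series_euler_product that) auto
    also have "(\<lambda>N. \<Prod>p | prime p \<and> p \<le> N. \<Sum>j. 1 * q m p ^ j) = (\<lambda>N. \<Prod>p | prime p \<and> p \<le> N. 1 / (1 - q m p))"
    proof (intro ext prod.cong refl)
      fix p N :: nat assume "p \<in> {p. prime p \<and> p \<le> N}"
      with q[of p m] show "(\<Sum>j. 1 * q m p ^ j) = 1 / (1 - q m p)"
        by (simp add: suminf_geometric)
    qed
    finally show "(\<lambda>N. \<Prod>p | prime p \<and> p \<le> N. 1 / (1 - q m p)) \<longlonglongrightarrow> Z m" .
    show "Z m \<ge> 1" unfolding Z_def by (rule dirichlet_series_euler_product(2)) (use that in auto)
  qed
  have b_bound: "norm (b k m) \<le> 8 * (1 / real k ^ 2)" for k m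
  proof (cases "prime k")
    case True
    have "norm (b k m) \<le> 8 * (q m k)\<^sup>2"
      using local_log_bound[of a "q m k", OF a q(1,3)[OF True]] True by (simp add: b_def L_def A_def x_def)
    also have "\<dots> \<le> 8 * (1 / real k)\<^sup>2" using q(1,2)[OF True] by (intro mult_left_mono power_mono) auto
    finally show ?thesis by (simp add: power_divide)
  qed (auto simp: b_def)
  have sm8: "summable (\<lambda>k. 8 * (1 / real k ^ 2))"
    by (intro summable_mult) (use inverse_power_summable[of 2, where 'a = real] in \<open>simp add: field_simps\<close>)
  have tannery: "eventually (\<lambda>m. summable (\<lambda>k. norm (b k m))) sequentially \<and> summable (\<lambda>k. norm (b' k)) \<and>
      ((\<lambda>m. suminf (\<lambda>k. b k m)) \<longlonglongrightarrow> suminf b')"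
  proof (rule tannerys_theorem[OF _ _ sm8])
    show "(\<lambda>m. b k m) \<longlonglongrightarrow> b' k" for k
    proof (cases "prime k")
      case True
      have k: "k \<ge> 2" using prime_ge_2_nat[OF True] .
      have t: "0 \<le> 1 / real k" "1 / real k \<le> 1 / 2" using k by (auto simp: field_simps)
      have "isCont A (1 / real k)" unfolding A_def
        by (rule isCont_powser[of _ "3/4"]) (use t a in \<open>auto intro!: local_series_summable\<close>)
      moreover have "A (1 / real k) \<ge> 1"
        unfolding A_def by (rule local_series_ge_1) (use a t in auto)
      ultimately have "isCont L (1 / real k)" unfolding L_def
        using t by (intro continuous_intros) auto
      moreover have "(\<lambda>m. q m k) \<longlonglongrightarrow> real k powr -(1 + 0)"
        unfolding q_def using k by (intro tendsto_intros) (real_asymp | simp)+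
      hence "(\<lambda>m. q m k) \<longlonglongrightarrow> 1 / real k" using k by (simp add: powr_minus_divide)
      ultimately have "(\<lambda>m. L (q m k)) \<longlonglongrightarrow> L (1 / real k)" by (rule isCont_tendsto_compose)
      thus ?thesis using True by (simp add: b_def b'_def)
    qed (auto simp: b_def b'_def)
    show "\<forall>\<^sub>F (k, m) in sequentially \<times>\<^sub>F sequentially. norm (b k m) \<le> 8 * (1 / real k ^ 2)"
      using b_bound by (intro always_eventually) auto
  qed auto
  \<comment> \<open>For \<open>s > 1\<close> the sum of logarithms compares the two Euler products, of \<open>F\<close> and of zeta.\<close>
  have exp_sum_b: "exp (suminf (\<lambda>k. b k m)) = F m * Z m powr (-x)" if m: "m > 0" for m
  proof (rule LIMSEQ_unique)
    have "summable (\<lambda>k. b k m)" by (rule summable_comparison_test'[OF sm8 b_bound])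
    thus "(\<lambda>N. exp (\<Sum>k\<le>N. b k m)) \<longlonglongrightarrow> exp (suminf (\<lambda>k. b k m))"
      by (intro tendsto_exp summable_LIMSEQ')
    have "(\<lambda>N. (\<Prod>p | prime p \<and> p \<le> N. A (q m p)) * (\<Prod>p | prime p \<and> p \<le> N. 1 / (1 - q m p)) powr (-x))
        \<longlonglongrightarrow> F m * Z m powr (-x)"
      using F_prod[OF m] Z_prod[OF m] Z_ge[OF m] by (intro tendsto_intros) auto
    also have "(\<lambda>N. (\<Prod>p | prime p \<and> p \<le> N. A (q m p)) * (\<Prod>p | prime p \<and> p \<le> N. 1 / (1 - q m p)) powr (-x)) =
        (\<lambda>N. exp (\<Sum>k\<le>N. b k m))"
    proof
      fix N
      have "exp (\<Sum>k\<le>N. b k m) = (\<Prod>p | prime p \<and> p \<le> N. exp (L (q m p)))"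
        unfolding b_def sum_primes_le by (rule exp_sum) auto
      also have "\<dots> = (\<Prod>p | prime p \<and> p \<le> N. A (q m p) * (1 / (1 - q m p)) powr (-x))"
      proof (rule prod.cong[OF refl])
        fix p assume "p \<in> {p. prime p \<and> p \<le> N}"
        with q[of p m] show "exp (L (q m p)) = A (q m p) * (1 / (1 - q m p)) powr (-x)"
          by (simp add: exp_L powr_divide powr_minus_divide)
      qed
      also have "\<dots> = (\<Prod>p | prime p \<and> p \<le> N. A (q m p)) * (\<Prod>p | prime p \<and> p \<le> N. 1 / (1 - q m p)) powr (-x)"
        using q by (subst prod_powr_distrib) (force simp: prod.distrib)+
      finally show "\<dots> = exp (\<Sum>k\<le>N. b k m)" ..
    qed
    finally show "(\<lambda>N. exp (\<Sum>k\<le>N. b k m)) \<longlonglongrightarrow> F m * Z m powr (-x)" .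
  qed
  have "exp (suminf b') = Gamma x * C"
  proof (rule LIMSEQ_unique)
    show "(\<lambda>m. exp (suminf (\<lambda>k. b k m))) \<longlonglongrightarrow> exp (suminf b')"
      using tannery by (intro tendsto_exp) auto
    have "(\<lambda>m. (F m * real m powr (-x)) * (Z m * real m powr (-1)) powr (-x)) \<longlonglongrightarrow> Gamma x * C * 1 powr (-x)"
      by (intro tendsto_intros F_lim Z_lim) auto
    moreover have "eventually (\<lambda>m. (F m * real m powr (-x)) * (Z m * real m powr (-1)) powr (-x) =
        exp (suminf (\<lambda>k. b k m))) sequentially"
      using eventually_gt_at_top[of 0]
    proof eventually_elim
      case (elim m)
      have "(real m powr (-1)) powr (-x) = real m powr x"
        unfolding powr_powr by simp
      hence "(Z m * real m powr (-1)) powr (-x) = Z m powr (-x) * real m powr x"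
        using Z_ge[OF elim] by (subst powr_mult) simp_all
      thus ?case using elim exp_sum_b[OF elim] by (simp add: powr_minus field_simps)
    qed
    ultimately show "(\<lambda>m. exp (suminf (\<lambda>k. b k m))) \<longlonglongrightarrow> Gamma x * C"
      by (simp add: Lim_transform_eventually)
  qed
  moreover have "(\<lambda>N. exp (\<Sum>k\<le>N. b' k)) \<longlonglongrightarrow> exp (suminf b')"
    using tannery by (intro tendsto_exp summable_LIMSEQ') (auto intro: summable_norm_cancel)
  moreover have "exp (\<Sum>k\<le>N. b' k) = (\<Prod>p | prime p \<and> p \<le> N. A (1 / real p) * (1 - 1 / real p) powr x)" for N
  proof -
    have "exp (\<Sum>k\<le>N. b' k) = (\<Prod>p | prime p \<and> p \<le> N. exp (L (1 / real p)))"
      unfolding b'_def sum_primes_le by (rule exp_sum) auto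
    also have "\<dots> = (\<Prod>p | prime p \<and> p \<le> N. A (1 / real p) * (1 - 1 / real p) powr x)"
      by (intro prod.cong refl exp_L) (auto simp: field_simps dest: prime_ge_2_nat)
    finally show ?thesis .
  qed
  ultimately show ?thesis by (simp add: A_def x_def)
qed

section \<open>The Weierstrass product over the primes\<close>

text \<open>The entire function whose zeros are exactly the primes, all of them simple. Both limiting functions
of the independent models are expressed through it: with \<open>E(z) = (1 - z) exp z\<close>, the factors at \<open>p\<close> are
\<open>E((1 - x)/p)\<close> for \<open>\<omega>\<close> and \<open>E(1/p) / E(x/p)\<close> for \<open>\<Omega>\<close>.\<close>

definition prime_weierstrass :: "complex \<Rightarrow> complex" where
  "prime_weierstrass z = (\<Prod>p. if prime p then weierstrass_factor 1 (z / of_nat p) else 1)"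

lemma weierstrass_factor_1_eq: "weierstrass_factor 1 z = (1 - z) * exp z"
  by (simp add: weierstrass_factor_def)

lemma prod_primes_le:
  fixes b :: "nat \<Rightarrow> 'a :: comm_monoid_mult"
  shows "(\<Prod>k\<le>N. if prime k then b k else 1) = (\<Prod>p | prime p \<and> p \<le> N. b p)"
  by (subst prod.inter_filter [symmetric]) (auto intro!: prod.cong)

lemma prime_weierstrass_factor_bound:
  assumes "norm z \<le> R" "real n \<ge> 2 * R" "n > 0"
  shows "norm ((if prime n then weierstrass_factor 1 (z / of_nat n) else 1) - 1) \<le> 3 * R\<^sup>2 * (1 / real n ^ 2)"
proof -
  have "norm (z / of_nat n) \<le> 1 / 2" using assms by (simp add: norm_divide field_simps)
  from weierstrass_factor_bound[OF this, of 1]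
  have "norm (weierstrass_factor 1 (z / of_nat n) - 1) \<le> 3 * (norm z ^ 2 / real n ^ 2)"
    by (simp add: norm_divide power_divide numeral_2_eq_2)
  also have "\<dots> \<le> 3 * (R ^ 2 / real n ^ 2)"
    using assms by (intro mult_left_mono divide_right_mono power_mono) auto
  finally show ?thesis by auto
qed

lemma prime_weierstrass_has_prod:
  "(\<lambda>p. if prime p then weierstrass_factor 1 (z / of_nat p) else 1) has_prod prime_weierstrass z"
proof -
  have "abs_convergent_prod (\<lambda>p. if prime p then weierstrass_factor 1 (z / of_nat p) else 1)"
    unfolding abs_convergent_prod_conv_summable
  proof (rule summable_comparison_test_ev)
    have "eventually (\<lambda>n. real n \<ge> 2 * norm z) sequentially" by real_asymp
    thus "\<forall>\<^sub>F n in sequentially. norm (norm ((if prime n then weierstrass_factor 1 (z / of_nat n) else 1) - 1))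
             \<le> 3 * norm z ^ 2 * (1 / real n ^ 2)"
      using eventually_gt_at_top[of 0]
      by eventually_elim (use prime_weierstrass_factor_bound[of z "norm z"] in simp)
    show "summable (\<lambda>n. 3 * norm z ^ 2 * (1 / real n ^ 2))"
      by (intro summable_mult) (use inverse_power_summable[of 2, where 'a = real] in \<open>simp add: field_simps\<close>)
  qed
  thus ?thesis
    unfolding prime_weierstrass_def
    by (intro convergent_prod_has_prod abs_convergent_prod_imp_convergent_prod)
qed

lemma prime_weierstrass_LIMSEQ:
  "(\<lambda>N. \<Prod>p | prime p \<and> p \<le> N. weierstrass_factor 1 (z / of_nat p)) \<longlonglongrightarrow> prime_weierstrass z"
  using has_prod_imp_tendsto[OF prime_weierstrass_has_prod, of z] by (simp add: prod_primes_le)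

lemma prime_weierstrass_eq_0_iff:
  "prime_weierstrass z = 0 \<longleftrightarrow> (\<exists>p. prime p \<and> z = of_nat p)"
proof -
  define F :: "nat \<Rightarrow> complex" where "F = (\<lambda>p. if prime p then weierstrass_factor 1 (z / of_nat p) else 1)"
  have "F has_prod prime_weierstrass z" unfolding F_def by (rule prime_weierstrass_has_prod)
  hence "prime_weierstrass z = 0 \<longleftrightarrow> 0 \<in> range F" by (rule has_prod_eq_0_iff)
  moreover have "0 = F p \<longleftrightarrow> prime p \<and> z = of_nat p" for p
    by (cases "p = 0"; cases "prime p") (auto simp: F_def)
  ultimately show ?thesis by (auto simp: image_iff)
qed

lemma prime_weierstrass_nonzero:
  assumes "norm z < 2"
  shows "prime_weierstrass z \<noteq> 0"
  using assms by (auto simp: prime_weierstrass_eq_0_iff dest!: prime_ge_2_nat)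

lemma prime_weierstrass_holomorphic: "prime_weierstrass holomorphic_on UNIV"
proof (rule holomorphic_uniform_sequence)
  define P where "P N z = (\<Prod>p<N. if prime p then weierstrass_factor 1 (z / of_nat p) else 1)" for N z
  show "P N holomorphic_on UNIV" for N unfolding P_def
  proof (intro holomorphic_intros)
    show "(\<lambda>z. if prime p then weierstrass_factor 1 (z / of_nat p) else 1) holomorphic_on UNIV" for p
      by (cases "p = 0"; cases "prime p") (auto intro!: holomorphic_intros)
  qed
  fix z :: complex
  define R where "R = norm z + 1"
  have "uniformly_convergent_on (cball z 1) P"
    unfolding P_def
  proof (rule uniformly_convergent_on_prod')
    show "continuous_on (cball z 1) (\<lambda>z. if prime n then weierstrass_factor 1 (z / of_nat n) else 1)" for n
      by (cases "n = 0"; cases "prime n") (auto intro!: continuous_intros)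
    show "uniformly_convergent_on (cball z 1) (\<lambda>N w. \<Sum>n<N. 
        norm ((if prime n then weierstrass_factor 1 (w / of_nat n) else 1) - 1))"
    proof (rule Weierstrass_m_test'_ev)
      have "eventually (\<lambda>n. real n \<ge> 2 * R) sequentially" by real_asymp
      thus "\<forall>\<^sub>F n in sequentially. \<forall>w\<in>cball z 1. norm (norm ((if prime n then weierstrass_factor 1 (w / of_nat n) else 1) - 1))
             \<le> 3 * R ^ 2 * (1 / real n ^ 2)"
        using eventually_gt_at_top[of 0]
      proof eventually_elim
        case (elim n)
        show ?case
        proof
          fix w assume "w \<in> cball z 1"
          hence "norm w \<le> R" using norm_triangle_sub[of w z] by (simp add: R_def dist_norm norm_minus_commute)
          thus "norm (norm ((if prime n then weierstrass_factor 1 (w / of_nat n) else 1) - 1)) \<le> 3 * R ^ 2 * (1 / real n ^ 2)"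
            using prime_weierstrass_factor_bound[of w R n] elim by simp
        qed
      qed
      show "summable (\<lambda>n. 3 * R ^ 2 * (1 / real n ^ 2))"
        by (intro summable_mult) (use inverse_power_summable[of 2, where 'a = real] in \<open>simp add: field_simps\<close>)
    qed
  qed auto
  then obtain g where g: "uniform_limit (cball z 1) P g sequentially"
    by (auto simp: uniformly_convergent_on_def)
  also have "?this \<longleftrightarrow> uniform_limit (cball z 1) P prime_weierstrass sequentially"
  proof (intro uniform_limit_cong)
    fix w assume "w \<in> cball z 1"
    with g have "(\<lambda>N. P N w) \<longlonglongrightarrow> g w" by (rule tendsto_uniform_limitI)
    moreover have "(\<lambda>N. P N w) \<longlonglongrightarrow> prime_weierstrass w"
      using has_prod_imp_tendsto'[OF prime_weierstrass_has_prod[of w]] by (simp add: P_def)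
    ultimately show "g w = prime_weierstrass w" by (rule LIMSEQ_unique)
  qed auto
  finally show "\<exists>d>0. cball z d \<subseteq> UNIV \<and> uniform_limit (cball z d) P prime_weierstrass sequentially"
    by (intro exI[of _ 1]) auto
qed auto

lemma Phi_hat_omega_eq: "Phi_hat_omega z = prime_weierstrass (1 - z)"
proof -
  have *: "weierstrass_factor 1 ((1 - z) / of_nat p) = (1 + (z - 1) / of_nat p) * exp (- ((z - 1) / of_nat p))" for p :: nat
    unfolding weierstrass_factor_1_eq by (simp add: diff_divide_distrib algebra_simps)
  show ?thesis unfolding Phi_hat_omega_def prime_weierstrass_def * ..
qed

lemma Phi_hat_Omega_eq:
  assumes "norm z < 2"
  shows "Phi_hat_Omega z = prime_weierstrass 1 / prime_weierstrass z"
proof -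
  have "(\<lambda>p. (if prime p then weierstrass_factor 1 (1 / of_nat p) else 1) /
        (if prime p then weierstrass_factor 1 (z / of_nat p) else 1)) has_prod
          (prime_weierstrass 1 / prime_weierstrass z)"
    by (intro has_prod_divide prime_weierstrass_has_prod prime_weierstrass_nonzero assms)
  also have "(\<lambda>p. (if prime p then weierstrass_factor 1 (1 / of_nat p) else 1) /
        (if prime p then weierstrass_factor 1 (z / of_nat p) else 1)) =
      (\<lambda>p. if prime p then (1 - 1 / of_nat p) / (1 - z / of_nat p) * exp (- ((z - 1) / of_nat p)) else 1)"
  proof
    fix p :: nat
    have e: "exp (- ((z - 1) / of_nat p)) = exp (1 / of_nat p) / exp (z / of_nat p)"
      by (simp add: exp_diff [symmetric] diff_divide_distrib)
    show "(if prime p then weierstrass_factor 1 (1 / of_nat p) else 1) /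
        (if prime p then weierstrass_factor 1 (z / of_nat p) else 1) =
      (if prime p then (1 - 1 / of_nat p) / (1 - z / of_nat p) * exp (- ((z - 1) / of_nat p)) else 1)"
      unfolding weierstrass_factor_1_eq e by simp
  qed
  finally show ?thesis unfolding Phi_hat_Omega_def by (rule has_prod_unique [symmetric])
qed

section \<open>Consequences of mod-Poisson convergence\<close>

lemma poisson_pgf:
  fixes z :: complex
  assumes c: "c > 0"
  shows "measure_pmf.expectation (poisson_pmf c) (\<lambda>k. z ^ k) = exp (of_real c * (z - 1))"
proof -
  define g where "g k = pmf (poisson_pmf c) k *\<^sub>R z ^ k" for k
  have g_eq: "g k = of_real (exp (-c)) * ((of_real c * z) ^ k /\<^sub>R fact k)" for k
    using c by (simp add: g_def scaleR_conv_of_real power_mult_distrib field_simps)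
  have sums: "g sums (of_real (exp (-c)) * exp (of_real c * z))"
    unfolding g_eq [abs_def] by (intro sums_mult exp_converges)
  have "summable (\<lambda>k. norm ((of_real c * z) ^ k /\<^sub>R fact k))"
    by (rule summable_norm_exp)
  hence "summable (\<lambda>k. norm (g k))"
    unfolding g_eq norm_mult by (rule summable_mult)
  hence int: "integrable (count_space UNIV) g" by (simp add: integrable_count_space_nat_iff)
  have "measure_pmf.expectation (poisson_pmf c) (\<lambda>k. z ^ k) = integral\<^sup>L (count_space UNIV) g"
    unfolding measure_pmf_eq_density g_def by (subst integral_density) auto
  also have "\<dots> = (\<Sum>k. g k)" by (rule integral_count_space_nat[OF int])
  also have "\<dots> = of_real (exp (-c)) * exp (of_real c * z)" using sums by (simp add: sums_iff)
  also have "\<dots> = exp (of_real c * (z - 1))"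
    by (simp add: exp_of_real [symmetric] exp_add [symmetric] algebra_simps)
  finally show ?thesis .
qed

lemma poisson_ratio_uniform:
  fixes n :: nat
  assumes "n > 0" "c > 0"
  shows "poisson_ratio (map_pmf h (pmf_of_set {1..n})) c z =
           ((\<Sum>k=1..n. z ^ h k) / of_nat n) / exp (of_real c * (z - 1))"
proof -
  have "measure_pmf.expectation (pmf_of_set {1..n}) (\<lambda>k. z ^ h k) = (\<Sum>k=1..n. z ^ h k) / of_nat n"
    using assms by (subst integral_measure_pmf[of "{1..n}"])
      (auto simp: scaleR_conv_of_real sum_divide_distrib)
  thus ?thesis using assms by (simp add: poisson_ratio_def poisson_pgf)
qed

lemma poisson_ratio_uniform_of_real:
  fixes n :: nat
  assumes "n > 0" "c > 0"
  shows "poisson_ratio (map_pmf h (pmf_of_set {1..n})) c (of_real x) =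
           of_real ((\<Sum>k=1..n. x ^ h k) / n / exp (c * (x - 1)))"
  unfolding poisson_ratio_uniform[OF assms] by (simp flip: exp_of_real)

text \<open>Each quotient of generating functions is a polynomial divided by a non-vanishing exponential, hence
entire, and locally uniform limits of holomorphic functions are holomorphic.\<close>

lemma mod_poisson_limit_holomorphic:
  assumes mp: "mod_poisson_on D (\<lambda>n. map_pmf h (pmf_of_set {1..n})) \<gamma> \<Phi>" and D: "open D"
  shows "\<Phi> holomorphic_on D"
proof -
  let ?X = "\<lambda>n. map_pmf h (pmf_of_set {1..n})"
  have pos: "eventually (\<lambda>n. 0 < \<gamma> n) sequentially" using mp by (simp add: mod_poisson_on_def)
  have "\<exists>e>0. \<Phi> holomorphic_on ball z e" if "z \<in> D" for z
  proof -
    from mp that obtain d where d: "d > 0"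
      and lim: "uniform_limit (cball z d) (\<lambda>n. poisson_ratio (?X n) (\<gamma> n)) \<Phi> sequentially"
      unfolding mod_poisson_on_def by blast
    have "eventually (\<lambda>n. continuous_on (cball z d) (poisson_ratio (?X n) (\<gamma> n)) \<and>
        poisson_ratio (?X n) (\<gamma> n) holomorphic_on ball z d) sequentially"
      using pos eventually_gt_at_top[of 0]
    proof eventually_elim
      case (elim n)
      have "(\<lambda>w. ((\<Sum>k=1..n. w ^ h k) / of_nat n) / exp (of_real (\<gamma> n) * (w - 1))) holomorphic_on UNIV"
        using elim by (intro holomorphic_intros) auto
      moreover have "poisson_ratio (?X n) (\<gamma> n) =
          (\<lambda>w. ((\<Sum>k=1..n. w ^ h k) / of_nat n) / exp (of_real (\<gamma> n) * (w - 1)))"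
        using elim by (intro ext poisson_ratio_uniform) auto
      ultimately have "poisson_ratio (?X n) (\<gamma> n) holomorphic_on UNIV" by simp
      thus ?case using holomorphic_on_imp_continuous_on holomorphic_on_subset by blast
    qed
    from holomorphic_uniform_limit[OF this lim] d show ?thesis by auto
  qed
  hence "\<Phi> analytic_on D" by (auto simp: analytic_on_def)
  thus ?thesis by (rule analytic_imp_holomorphic)
qed

text \<open>At speed \<open>ln ln n + \<kappa>\<close> the Poisson generating function is \<open>(ln n)^(x-1) exp (\<kappa> (x-1))\<close>. Convergence at
the real point \<open>x\<close> is therefore an asymptotic formula for the mean of \<open>x ^ h k\<close> over \<open>k \<le> n\<close>.\<close>

lemma mod_poisson_mean_value:
  fixes x \<kappa> :: real
  assumes mp: "mod_poisson_on D (\<lambda>n. map_pmf h (pmf_of_set {1..n})) (\<lambda>n. ln (ln (real n)) + \<kappa>) \<Phi>"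
    and x: "of_real x \<in> D"
  obtains C where "\<Phi> (of_real x) * of_real (exp (\<kappa> * (x - 1))) = of_real C"
    and "(\<lambda>n. (\<Sum>k=1..n. x ^ h k) / (real n * ln (real n) powr (x - 1))) \<longlonglongrightarrow> C"
proof -
  let ?X = "\<lambda>n. map_pmf h (pmf_of_set {1..n})"
  define \<gamma> where "\<gamma> n = ln (ln (real n)) + \<kappa>" for n :: nat
  define s where "s n = (\<Sum>k=1..n. x ^ h k) / (real n * ln (real n) powr (x - 1))" for n
  define w where "w = \<Phi> (of_real x) * of_real (exp (\<kappa> * (x - 1)))"
  have pos: "eventually (\<lambda>n. 0 < \<gamma> n) sequentially" using mp by (simp add: mod_poisson_on_def \<gamma>_def)
  from mp x obtain d where d: "d > 0"
      and lim: "uniform_limit (cball (of_real x) d) (\<lambda>n. poisson_ratio (?X n) (\<gamma> n)) \<Phi> sequentially"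
    unfolding mod_poisson_on_def \<gamma>_def by blast
  have "(\<lambda>n. poisson_ratio (?X n) (\<gamma> n) (of_real x)) \<longlonglongrightarrow> \<Phi> (of_real x)"
    using d by (intro tendsto_uniform_limitI[OF lim]) auto
  hence "(\<lambda>n. poisson_ratio (?X n) (\<gamma> n) (of_real x) * of_real (exp (\<kappa> * (x - 1)))) \<longlonglongrightarrow> w"
    unfolding w_def by (intro tendsto_intros)
  moreover have "eventually (\<lambda>n. poisson_ratio (?X n) (\<gamma> n) (of_real x) * of_real (exp (\<kappa> * (x - 1))) =
      of_real (s n)) sequentially"
    using pos eventually_gt_at_top[of 1]
  proof eventually_elim
    case (elim n)
    have exp_speed: "exp (\<gamma> n * (x - 1)) = ln (real n) powr (x - 1) * exp (\<kappa> * (x - 1))"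
      using elim by (simp add: \<gamma>_def powr_def exp_add [symmetric] algebra_simps)
    have "poisson_ratio (?X n) (\<gamma> n) (of_real x) =
        of_real ((\<Sum>k=1..n. x ^ h k) / n / exp (\<gamma> n * (x - 1)))"
      by (rule poisson_ratio_uniform_of_real) (use elim in auto)
    moreover have "(\<Sum>k=1..n. x ^ h k) / n / exp (\<gamma> n * (x - 1)) * exp (\<kappa> * (x - 1)) = s n"
      unfolding s_def exp_speed by simp
    ultimately show ?case by (simp only: flip: of_real_mult)
  qed
  ultimately have lim_s: "(\<lambda>n. complex_of_real (s n)) \<longlonglongrightarrow> w"
    by (simp add: Lim_transform_eventually)
  have "s \<longlonglongrightarrow> Re w" using tendsto_Re[OF lim_s] by simp
  moreover from this have "w = of_real (Re w)"
    using lim_s tendsto_of_real[of s "Re w" sequentially, where 'a = complex] LIMSEQ_unique by blast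
  ultimately show ?thesis using that unfolding s_def w_def by blast
qed

section \<open>The Euler products of the two arithmetic functions\<close>

lemma mult_ext_omega: "mult_ext (\<lambda>j. if j = 0 then 1 else x) n = x ^ omega n"
proof -
  have "mult_ext (\<lambda>j. if j = 0 then 1 else x) n = (\<Prod>p\<in>prime_factors n. x)"
    unfolding mult_ext_def by (rule prod.cong) (auto simp: prime_factors_multiplicity)
  thus ?thesis by (simp add: omega_def)
qed

lemma mult_ext_Omega: "mult_ext (\<lambda>j. x ^ j) n = x ^ Omega n"
proof -
  have "Omega n = (\<Sum>p\<in>prime_factors n. multiplicity p n)"
    unfolding Omega_def size_multiset_overloaded_eq
    by (rule sum.cong) (auto simp: count_prime_factorization_prime in_prime_factors_imp_prime)
  thus ?thesis by (simp add: mult_ext_def power_sum)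
qed

lemma omega_local_series:
  fixes x t :: real
  assumes "0 \<le> t" "t < 1"
  shows "(\<Sum>j. (if j = 0 then 1 else x) * t ^ j) = (1 - (1 - x) * t) / (1 - t)"
proof -
  have "(\<lambda>j. x * t ^ j) sums (x * (1 / (1 - t)))"
    using assms by (intro sums_mult geometric_sums) auto
  moreover have "(\<lambda>j. if j = 0 then 1 - x else 0) sums (1 - x)"
    using sums_single[of 0 "\<lambda>_. 1 - x"] by simp
  ultimately have "(\<lambda>j. x * t ^ j + (if j = 0 then 1 - x else 0)) sums (x * (1 / (1 - t)) + (1 - x))"
    by (rule sums_add)
  also have "(\<lambda>j. x * t ^ j + (if j = 0 then 1 - x else 0)) = (\<lambda>j. (if j = 0 then 1 else x) * t ^ j)"
    by auto
  also have "x * (1 / (1 - t)) + (1 - x) = (1 - (1 - x) * t) / (1 - t)"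
    using assms by (simp add: field_simps)
  finally show ?thesis by (simp add: sums_iff)
qed

lemma Omega_local_series:
  fixes x t :: real
  assumes "0 \<le> x" "x \<le> 1" "0 \<le> t" "t < 1"
  shows "(\<Sum>j. x ^ j * t ^ j) = 1 / (1 - x * t)"
proof -
  have "x * t \<le> 1 * t" using assms by (intro mult_right_mono) auto
  hence "norm (x * t) < 1" using assms by simp
  thus ?thesis by (simp add: suminf_geometric flip: power_mult_distrib)
qed

text \<open>All factors at 1 are positive reals and none of the zeros is at 1, so that real powers of the value at 1
make sense; its logarithm is the constant produced by the Euler products.\<close>

lemma prime_weierstrass_1_pos:
  obtains w where "w > 0" "prime_weierstrass 1 = of_real w"
    "(\<lambda>N. \<Prod>p | prime p \<and> p \<le> N. (1 - 1 / real p) * exp (1 / real p)) \<longlonglongrightarrow> w"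
proof -
  define P where "P N = (\<Prod>p | prime p \<and> p \<le> N. (1 - 1 / real p) * exp (1 / real p))" for N
  have lim: "(\<lambda>N. complex_of_real (P N)) \<longlonglongrightarrow> prime_weierstrass 1"
    using prime_weierstrass_LIMSEQ[of 1] unfolding weierstrass_factor_1_eq
    by (simp add: P_def flip: exp_of_real)
  have P: "P \<longlonglongrightarrow> Re (prime_weierstrass 1)" using tendsto_Re[OF lim] by simp
  hence eq: "prime_weierstrass 1 = of_real (Re (prime_weierstrass 1))"
    using lim tendsto_of_real[of P "Re (prime_weierstrass 1)" sequentially, where 'a = complex] LIMSEQ_unique by blast
  have "P N \<ge> 0" for N unfolding P_def
    by (intro prod_nonneg mult_nonneg_nonneg) (auto simp: field_simps dest: prime_ge_1_nat)
  hence "Re (prime_weierstrass 1) \<ge> 0" by (intro LIMSEQ_le_const[OF P]) auto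
  moreover have "prime_weierstrass 1 \<noteq> 0"
    by (auto simp: prime_weierstrass_eq_0_iff)
  hence "Re (prime_weierstrass 1) \<noteq> 0" using eq by (metis of_real_0)
  ultimately show ?thesis using that[OF _ eq] P unfolding P_def by force
qed

text \<open>Factor by factor, \<open>A(t) (1-t)^x = E((1-x) t) E(t)^(x-1)\<close> for the local series
\<open>A(t) = (1 - (1-x) t) / (1-t)\<close> of \<open>x ^ omega k\<close> and \<open>E(t) = (1-t) exp t\<close>. The second factor contributes
\<open>w^(x-1)\<close>, the source of the exponential in the final formula.\<close>

lemma omega_euler_product:
  fixes x :: real
  assumes w: "w > 0" "(\<lambda>N. \<Prod>p | prime p \<and> p \<le> N. (1 - 1 / real p) * exp (1 / real p)) \<longlonglongrightarrow> w"
  assumes lim: "(\<lambda>N. \<Prod>p | prime p \<and> p \<le> N. (\<Sum>j. (if j = 0 then 1 else x) * (1 / real p) ^ j) *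
            (1 - 1 / real p) powr x) \<longlonglongrightarrow> l"
  shows "complex_of_real l = Phi_hat_omega (of_real x) * of_real (w powr (x - 1))"
proof (rule LIMSEQ_unique)
  show "(\<lambda>N. complex_of_real (\<Prod>p | prime p \<and> p \<le> N. (\<Sum>j. (if j = 0 then 1 else x) * (1 / real p) ^ j) *
            (1 - 1 / real p) powr x)) \<longlonglongrightarrow> of_real l"
    by (intro tendsto_of_real lim)
  have "(\<lambda>N. (\<Prod>p | prime p \<and> p \<le> N. weierstrass_factor 1 ((1 - of_real x) / of_nat p)) *
          complex_of_real ((\<Prod>p | prime p \<and> p \<le> N. (1 - 1 / real p) * exp (1 / real p)) powr (x - 1)))
        \<longlonglongrightarrow> prime_weierstrass (1 - of_real x) * of_real (w powr (x - 1))"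
    using w by (intro tendsto_intros prime_weierstrass_LIMSEQ) auto
  also have "(\<lambda>N. (\<Prod>p | prime p \<and> p \<le> N. weierstrass_factor 1 ((1 - of_real x) / of_nat p)) *
          complex_of_real ((\<Prod>p | prime p \<and> p \<le> N. (1 - 1 / real p) * exp (1 / real p)) powr (x - 1))) =
      (\<lambda>N. complex_of_real (\<Prod>p | prime p \<and> p \<le> N. (\<Sum>j. (if j = 0 then 1 else x) * (1 / real p) ^ j) *
            (1 - 1 / real p) powr x))"
  proof
    fix N :: nat
    have "(\<Prod>p | prime p \<and> p \<le> N. (\<Sum>j. (if j = 0 then 1 else x) * (1 / real p) ^ j) * (1 - 1 / real p) powr x) =
      (\<Prod>p | prime p \<and> p \<le> N. (1 - (1 - x) / real p) * exp ((1 - x) / real p) *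
         ((1 - 1 / real p) * exp (1 / real p)) powr (x - 1))"
    proof (rule prod.cong[OF refl])
      fix p assume "p \<in> {p. prime p \<and> p \<le> N}"
      hence p: "real p \<ge> 2" using prime_ge_2_nat[of p] by auto
      have "((1 - 1 / real p) * exp (1 / real p)) powr (x - 1) = (1 - 1 / real p) powr (x - 1) * exp ((x - 1) / real p)"
        using p by (subst powr_mult) (auto simp: powr_def[of "exp _"])
      moreover have "exp ((1 - x) / real p) * exp ((x - 1) / real p) = 1"
        by (simp add: exp_add [symmetric] diff_divide_distrib)
      moreover have "(1 - 1 / real p) powr (x - 1) = (1 - 1 / real p) powr x / (1 - 1 / real p)"
        using p by (simp add: powr_diff)
      ultimately show "(\<Sum>j. (if j = 0 then 1 else x) * (1 / real p) ^ j) * (1 - 1 / real p) powr x =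
          (1 - (1 - x) / real p) * exp ((1 - x) / real p) * ((1 - 1 / real p) * exp (1 / real p)) powr (x - 1)"
        using p omega_local_series[of "1 / real p" x] by (simp add: mult_ac)
    qed
    also have "\<dots> = (\<Prod>p | prime p \<and> p \<le> N. (1 - (1 - x) / real p) * exp ((1 - x) / real p)) *
       (\<Prod>p | prime p \<and> p \<le> N. (1 - 1 / real p) * exp (1 / real p)) powr (x - 1)"
      unfolding prod_powr_distrib by (rule prod.distrib)
    finally show "(\<Prod>p | prime p \<and> p \<le> N. weierstrass_factor 1 ((1 - of_real x) / of_nat p)) *
          complex_of_real ((\<Prod>p | prime p \<and> p \<le> N. (1 - 1 / real p) * exp (1 / real p)) powr (x - 1)) =
       complex_of_real (\<Prod>p | prime p \<and> p \<le> N. (\<Sum>j. (if j = 0 then 1 else x) * (1 / real p) ^ j) *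
            (1 - 1 / real p) powr x)"
      unfolding weierstrass_factor_1_eq by (simp flip: exp_of_real)
  qed
  finally show "(\<lambda>N. complex_of_real (\<Prod>p | prime p \<and> p \<le> N. (\<Sum>j. (if j = 0 then 1 else x) * (1 / real p) ^ j) *
            (1 - 1 / real p) powr x)) \<longlonglongrightarrow> Phi_hat_omega (of_real x) * of_real (w powr (x - 1))"
    by (simp only: Phi_hat_omega_eq)
qed

text \<open>Here \<open>A(t) = 1 / (1 - x t)\<close>, and \<open>A(t) (1-t)^x = E(t)^x / E(x t)\<close>, again with \<open>E(t) = (1-t) exp t\<close>.
One power of \<open>w\<close> is absorbed by the numerator of the limiting function of the independent model.\<close>

lemma Omega_euler_product:
  fixes x :: real
  assumes w: "w > 0" "prime_weierstrass 1 = of_real w"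
     "(\<lambda>N. \<Prod>p | prime p \<and> p \<le> N. (1 - 1 / real p) * exp (1 / real p)) \<longlonglongrightarrow> w"
  assumes x: "0 \<le> x" "x \<le> 1"
  assumes lim: "(\<lambda>N. \<Prod>p | prime p \<and> p \<le> N. (\<Sum>j. x ^ j * (1 / real p) ^ j) * (1 - 1 / real p) powr x) \<longlonglongrightarrow> l"
  shows "complex_of_real l = Phi_hat_Omega (of_real x) * of_real (w powr (x - 1))"
proof (rule LIMSEQ_unique)
  show "(\<lambda>N. complex_of_real (\<Prod>p | prime p \<and> p \<le> N. (\<Sum>j. x ^ j * (1 / real p) ^ j) * (1 - 1 / real p) powr x)) 
    \<longlonglongrightarrow> of_real l"
    by (intro tendsto_of_real lim)
  have nz: "prime_weierstrass (of_real x) \<noteq> 0"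
    using x by (intro prime_weierstrass_nonzero) simp
  have "(\<lambda>N. complex_of_real ((\<Prod>p | prime p \<and> p \<le> N. (1 - 1 / real p) * exp (1 / real p)) powr x) /
           (\<Prod>p | prime p \<and> p \<le> N. weierstrass_factor 1 (of_real x / of_nat p)))
        \<longlonglongrightarrow> of_real (w powr x) / prime_weierstrass (of_real x)"
    using w nz by (intro tendsto_intros prime_weierstrass_LIMSEQ) auto
  also have "(\<lambda>N. complex_of_real ((\<Prod>p | prime p \<and> p \<le> N. (1 - 1 / real p) * exp (1 / real p)) powr x) /
           (\<Prod>p | prime p \<and> p \<le> N. weierstrass_factor 1 (of_real x / of_nat p))) =
      (\<lambda>N. complex_of_real (\<Prod>p | prime p \<and> p \<le> N. (\<Sum>j. x ^ j * (1 / real p) ^ j) * (1 - 1 / real p) powr x))"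
  proof
    fix N :: nat
    have "(\<Prod>p | prime p \<and> p \<le> N. (\<Sum>j. x ^ j * (1 / real p) ^ j) * (1 - 1 / real p) powr x) =
      (\<Prod>p | prime p \<and> p \<le> N. ((1 - 1 / real p) * exp (1 / real p)) powr x / ((1 - x / real p) * exp (x / real p)))"
    proof (rule prod.cong[OF refl])
      fix p assume "p \<in> {p. prime p \<and> p \<le> N}"
      hence p: "real p \<ge> 2" using prime_ge_2_nat[of p] by auto
      have "((1 - 1 / real p) * exp (1 / real p)) powr x = (1 - 1 / real p) powr x * exp (x / real p)"
        using p by (subst powr_mult) (auto simp: powr_def[of "exp _"])
      thus "(\<Sum>j. x ^ j * (1 / real p) ^ j) * (1 - 1 / real p) powr x =
          ((1 - 1 / real p) * exp (1 / real p)) powr x / ((1 - x / real p) * exp (x / real p))"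
        using p x Omega_local_series[of x "1 / real p"] by simp
    qed
    also have "\<dots> = (\<Prod>p | prime p \<and> p \<le> N. (1 - 1 / real p) * exp (1 / real p)) powr x /
        (\<Prod>p | prime p \<and> p \<le> N. (1 - x / real p) * exp (x / real p))"
      unfolding prod_powr_distrib by (rule prod_dividef)
    finally show "complex_of_real ((\<Prod>p | prime p \<and> p \<le> N. (1 - 1 / real p) * exp (1 / real p)) powr x) /
           (\<Prod>p | prime p \<and> p \<le> N. weierstrass_factor 1 (of_real x / of_nat p)) =
      complex_of_real (\<Prod>p | prime p \<and> p \<le> N. (\<Sum>j. x ^ j * (1 / real p) ^ j) * (1 - 1 / real p) powr x)"
      unfolding weierstrass_factor_1_eq by (simp flip: exp_of_real)
  qed
  also have "complex_of_real (w powr x) / prime_weierstrass (of_real x) =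
     Phi_hat_Omega (of_real x) * of_real (w powr (x - 1))"
    using x w by (simp add: Phi_hat_Omega_eq powr_diff)
  finally show "(\<lambda>N. complex_of_real (\<Prod>p | prime p \<and> p \<le> N. (\<Sum>j. x ^ j * (1 / real p) ^ j) * (1 - 1 / real p) powr x))
     \<longlonglongrightarrow> Phi_hat_Omega (of_real x) * of_real (w powr (x - 1))" .
qed

section \<open>Identification of the limiting functions\<close>

lemma holomorphic_eqI_unit_interval:
  assumes "f holomorphic_on D" "g holomorphic_on D" "open D" "connected D"
    and sub: "complex_of_real ` {0<..<1} \<subseteq> D"
    and eq: "\<And>x::real. 0 < x \<Longrightarrow> x < 1 \<Longrightarrow> f (of_real x) = g (of_real x)"
    and z: "z \<in> D"
  shows "f z = g z"
proof -
  have "(1/2 :: complex) \<in> D" using sub by (auto simp: image_subset_iff dest: bspec[of _ _ "1/2"])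
  moreover have "(1/2 :: complex) islimpt (complex_of_real ` {0<..<1})"
    unfolding islimpt_approachable
  proof (intro allI impI)
    fix e :: real assume "e > 0"
    \<comment> \<open>Half the distance \<open>e\<close>, cut off at 1/4 to stay inside the unit interval.\<close>
    define y where "y = 1 / 2 + min (e / 2) (1 / 4)"
    have "y \<in> {0<..<1}" "y \<noteq> 1 / 2" "\<bar>y - 1 / 2\<bar> < e" using \<open>e > 0\<close> by (auto simp: y_def)
    moreover have dist: "dist (complex_of_real y) (1 / 2) = \<bar>y - 1 / 2\<bar>"
      using norm_of_real[of "y - 1 / 2", where 'a = complex] by (simp add: dist_norm)
    moreover have "complex_of_real y \<noteq> 1 / 2"
      using \<open>y \<noteq> 1 / 2\<close> dist by (metis abs_eq_0 dist_eq_0_iff right_minus_eq)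
    ultimately show "\<exists>x'\<in>complex_of_real ` {0<..<1}. x' \<noteq> 1 / 2 \<and> dist x' (1 / 2) < e"
      by (intro bexI[of _ "complex_of_real y"]) auto
  qed
  ultimately have "(\<lambda>z. f z - g z) z = 0"
    using assms by (intro analytic_continuation[of "\<lambda>z. f z - g z" D "complex_of_real ` {0<..<1}" "1/2" z])
      (auto intro!: holomorphic_intros)
  thus ?thesis by simp
qed

text \<open>On \<open>(0,1)\<close> the hypotheses give \<open>\<Phi> x exp (\<kappa> (x-1)) Gamma x = H x w^(x-1)\<close>, hence the formula with
\<open>\<kappa>' = ln w - \<kappa>\<close>. Both sides are holomorphic on \<open>D\<close>, because the reciprocal Gamma function is
entire, so the identity persists on \<open>D\<close>.\<close>

lemma limit_function_identification:
  fixes \<kappa> w :: real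
  assumes mp: "mod_poisson_on D (\<lambda>n. map_pmf h (pmf_of_set {1..n})) (\<lambda>n. ln (ln (real n)) + \<kappa>) \<Phi>"
    and D: "open D" "connected D" "complex_of_real ` {0<..<1} \<subseteq> D"
    and H: "H holomorphic_on D" and w: "w > 0"
    and id: "\<And>x C. 0 < x \<Longrightarrow> x < 1 \<Longrightarrow>
       (\<lambda>n. (\<Sum>k=1..n. x ^ h k) / (real n * ln (real n) powr (x - 1))) \<longlonglongrightarrow> C \<Longrightarrow>
       complex_of_real (Gamma x * C) = H (of_real x) * of_real (w powr (x - 1))"
  shows "\<exists>\<kappa>'::real. \<forall>z\<in>D. \<Phi> z = exp (of_real \<kappa>' * (z - 1)) / Gamma z * H z"
proof (intro exI[of _ "ln w - \<kappa>"] ballI)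
  fix z assume z: "z \<in> D"
  have "\<Phi> z = exp (of_real (ln w - \<kappa>) * (z - 1)) * rGamma z * H z"
  proof (rule holomorphic_eqI_unit_interval[OF _ _ D _ z])
    show "\<Phi> holomorphic_on D" by (rule mod_poisson_limit_holomorphic[OF mp D(1)])
    show "(\<lambda>z. exp (of_real (ln w - \<kappa>) * (z - 1)) * rGamma z * H z) holomorphic_on D"
      by (intro holomorphic_intros H)
    fix x :: real assume x: "0 < x" "x < 1"
    hence xD: "of_real x \<in> D" using D(3) by auto
    obtain C where C: "\<Phi> (of_real x) * of_real (exp (\<kappa> * (x - 1))) = of_real C"
      and lim: "(\<lambda>n. (\<Sum>k=1..n. x ^ h k) / (real n * ln (real n) powr (x - 1))) \<longlonglongrightarrow> C"
      using mod_poisson_mean_value[OF mp xD] .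
    have G: "Gamma x > 0" using x by simp
    have "\<Phi> (of_real x) = of_real C * of_real (exp (-\<kappa> * (x - 1)))"
      unfolding C [symmetric] by (simp add: mult.assoc flip: of_real_mult exp_add)
    also have "complex_of_real C = complex_of_real (Gamma x * C) * of_real (rGamma x)"
      using G by (simp add: rGamma_inverse_Gamma field_simps)
    also have "complex_of_real (Gamma x * C) = H (of_real x) * of_real (w powr (x - 1))"
      by (rule id[OF x lim])
    also have "w powr (x - 1) = exp (ln w * (x - 1))" using w by (simp add: powr_def)
    also have "H (of_real x) * of_real (exp (ln w * (x - 1))) * of_real (rGamma x) * of_real (exp (-\<kappa> * (x - 1))) =
       of_real (exp (ln w * (x - 1)) * exp (-\<kappa> * (x - 1))) * rGamma (complex_of_real x) * H (of_real x)"
      by (simp add: rGamma_complex_of_real)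
    also have "exp (ln w * (x - 1)) * exp (-\<kappa> * (x - 1)) = exp ((ln w - \<kappa>) * (x - 1))"
      by (simp add: exp_add [symmetric] algebra_simps)
    also have "complex_of_real \<dots> = exp (of_real (ln w - \<kappa>) * (of_real x - 1))"
      by (simp flip: exp_of_real)
    finally show "\<Phi> (of_real x) = exp (of_real (ln w - \<kappa>) * (of_real x - 1)) * rGamma (of_real x) * H (of_real x)" .
  qed
  thus "\<Phi> z = exp (of_real (ln w - \<kappa>) * (z - 1)) / Gamma z * H z"
    by (simp add: rGamma_inverse_Gamma divide_inverse)
qed

lemma Omega_power_of_2: "Omega (2 ^ m) = m"
  by (simp add: Omega_def prime_factorization_prime_power)

text \<open>At \<open>z = 4\<close> the single integer \<open>2 ^ m\<close> contributes \<open>4 ^ m\<close> to the sum of \<open>z ^ Omega k\<close> over \<open>k \<le> 2 ^ m\<close>,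
whereas mod-Poisson convergence forces that sum to be of order at most \<open>2 ^ m m^3\<close>. This is the effect of the
pole of the limiting function at 2.\<close>

lemma Omega_not_mod_poisson_on_UNIV:
  "\<not> mod_poisson_on UNIV Omega_law (\<lambda>n. ln (ln (real n)) + \<kappa>) \<Phi>"
proof
  assume mp: "mod_poisson_on UNIV Omega_law (\<lambda>n. ln (ln (real n)) + \<kappa>) \<Phi>"
  obtain C where lim: "(\<lambda>n. (\<Sum>k=1..n. (4::real) ^ Omega k) / (real n * ln (real n) powr (4 - 1))) \<longlonglongrightarrow> C"
    using mod_poisson_mean_value[of UNIV Omega \<kappa> \<Phi> 4] mp unfolding Omega_law_def by auto
  have "filterlim (\<lambda>m. (2::nat) ^ m) at_top sequentially"
    by (rule filterlim_subseq) (auto simp: strict_mono_def)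
  from filterlim_compose[OF lim this]
  have "(\<lambda>m. (\<Sum>k=1..2 ^ m. (4::real) ^ Omega k) / (real (2 ^ m) * ln (real (2 ^ m)) powr (4 - 1))) \<longlonglongrightarrow> C" .
  moreover have "filterlim (\<lambda>m. (\<Sum>k=1..2 ^ m. (4::real) ^ Omega k) / (real (2 ^ m) * ln (real (2 ^ m)) powr (4 - 1)))
     at_top sequentially"
  proof (rule filterlim_at_top_mono)
    show "filterlim (\<lambda>m. 4 ^ m / (2 ^ m * (real m * ln 2) powr 3) :: real) at_top sequentially"
      by real_asymp
    show "eventually (\<lambda>m. 4 ^ m / (2 ^ m * (real m * ln 2) powr 3) \<le>
       (\<Sum>k=1..2 ^ m. (4::real) ^ Omega k) / (real (2 ^ m) * ln (real (2 ^ m)) powr (4 - 1))) sequentially"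
    proof (intro always_eventually allI)
      fix m :: nat
      have "(\<Sum>k\<in>{2 ^ m}. (4::real) ^ Omega k) \<le> (\<Sum>k=1..2 ^ m. (4::real) ^ Omega k)"
        by (intro sum_mono2) auto
      hence "(4::real) ^ m \<le> (\<Sum>k=1..2 ^ m. (4::real) ^ Omega k)" by (simp add: Omega_power_of_2)
      thus "4 ^ m / (2 ^ m * (real m * ln 2) powr 3) \<le>
         (\<Sum>k=1..2 ^ m. (4::real) ^ Omega k) / (real (2 ^ m) * ln (real (2 ^ m)) powr (4 - 1))"
        by (simp add: ln_realpow divide_right_mono)
    qed
  qed
  ultimately show False
    using not_tendsto_and_filterlim_at_infinity[OF sequentially_bot _ filterlim_at_top_imp_at_infinity] by blast
qed

theorem theorem4p8:
  fixes \<kappa> :: real and \<Phi>_omega \<Phi>_Omega :: "complex \<Rightarrow> complex"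
  shows
    "(mod_poisson_on UNIV omega_law (\<lambda>n. ln (ln (real n)) + \<kappa>) \<Phi>_omega \<and>
      log_rate_on UNIV omega_law (\<lambda>n. ln (ln (real n)) + \<kappa>) \<Phi>_omega \<longrightarrow>
      (\<exists>\<kappa>' :: real. \<forall>x. \<Phi>_omega x =
         exp (complex_of_real \<kappa>' * (x - 1)) / Gamma x * Phi_hat_omega x)) \<and>
     (\<forall>D \<in> {UNIV, ball 0 2}.
      mod_poisson_on D Omega_law (\<lambda>n. ln (ln (real n)) + \<kappa>) \<Phi>_Omega \<and>
      log_rate_on D Omega_law (\<lambda>n. ln (ln (real n)) + \<kappa>) \<Phi>_Omega \<longrightarrow>
      (\<exists>\<kappa>' :: real. \<forall>x\<in>D. \<Phi>_Omega x =
         exp (complex_of_real \<kappa>' * (x - 1)) / Gamma x * Phi_hat_Omega x))"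
proof (intro conjI ballI impI)
  obtain w where w: "w > 0" "prime_weierstrass 1 = of_real w"
    "(\<lambda>N. \<Prod>p | prime p \<and> p \<le> N. (1 - 1 / real p) * exp (1 / real p)) \<longlonglongrightarrow> w"
    using prime_weierstrass_1_pos .
  {
    assume "mod_poisson_on UNIV omega_law (\<lambda>n. ln (ln (real n)) + \<kappa>) \<Phi>_omega \<and>
      log_rate_on UNIV omega_law (\<lambda>n. ln (ln (real n)) + \<kappa>) \<Phi>_omega"
    hence mp: "mod_poisson_on UNIV (\<lambda>n. map_pmf omega (pmf_of_set {1..n})) (\<lambda>n. ln (ln (real n)) + \<kappa>) \<Phi>_omega"
      by (simp add: omega_law_def [abs_def])
    have "\<exists>\<kappa>' :: real. \<forall>x\<in>UNIV. \<Phi>_omega x = exp (complex_of_real \<kappa>' * (x - 1)) / Gamma x * Phi_hat_omega x"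
    proof (rule limit_function_identification[OF mp _ _ _ _ w(1)])
      have "(prime_weierstrass \<circ> (\<lambda>z. 1 - z)) holomorphic_on UNIV"
        by (intro holomorphic_on_compose_gen[OF _ prime_weierstrass_holomorphic] holomorphic_intros) auto
      thus "Phi_hat_omega holomorphic_on UNIV" by (simp add: Phi_hat_omega_eq o_def cong: holomorphic_cong)
      fix x C :: real
      assume x: "0 < x" "x < 1"
      assume "(\<lambda>n. (\<Sum>k=1..n. x ^ omega k) / (real n * ln (real n) powr (x - 1))) \<longlonglongrightarrow> C"
      hence "(\<lambda>N. \<Prod>p | prime p \<and> p \<le> N. (\<Sum>j. (if j = 0 then 1 else x) * (1 / real p) ^ j) * (1 - 1 / real p) powr x)
           \<longlonglongrightarrow> Gamma x * C"
        using x mean_value_euler_product[of "\<lambda>j. if j = 0 then 1 else x" C] by (simp add: mult_ext_omega)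
      thus "complex_of_real (Gamma x * C) = Phi_hat_omega (of_real x) * of_real (w powr (x - 1))"
        by (rule omega_euler_product[OF w(1,3)])
    qed auto
    thus "\<exists>\<kappa>' :: real. \<forall>x. \<Phi>_omega x = exp (complex_of_real \<kappa>' * (x - 1)) / Gamma x * Phi_hat_omega x"
      by simp
  }
  {
    fix D :: "complex set" assume D: "D \<in> {UNIV, ball 0 2}"
    assume hyp: "mod_poisson_on D Omega_law (\<lambda>n. ln (ln (real n)) + \<kappa>) \<Phi>_Omega \<and>
      log_rate_on D Omega_law (\<lambda>n. ln (ln (real n)) + \<kappa>) \<Phi>_Omega"
    with D Omega_not_mod_poisson_on_UNIV have D_eq: "D = ball 0 2" by auto
    from hyp have mp: "mod_poisson_on D (\<lambda>n. map_pmf Omega (pmf_of_set {1..n})) (\<lambda>n. ln (ln (real n)) + \<kappa>) \<Phi>_Omega"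
      by (simp add: Omega_law_def [abs_def])
    show "\<exists>\<kappa>' :: real. \<forall>x\<in>D. \<Phi>_Omega x = exp (complex_of_real \<kappa>' * (x - 1)) / Gamma x * Phi_hat_Omega x"
    proof (rule limit_function_identification[OF mp _ _ _ _ w(1)])
      have "(\<lambda>z. prime_weierstrass 1 / prime_weierstrass z) holomorphic_on D"
        using prime_weierstrass_holomorphic
        by (intro holomorphic_intros) (auto simp: D_eq intro: holomorphic_on_subset dest: prime_weierstrass_nonzero)
      thus "Phi_hat_Omega holomorphic_on D"
        by (rule holomorphic_transform) (auto simp: D_eq Phi_hat_Omega_eq)
      fix x C :: real
      assume x: "0 < x" "x < 1"
      assume "(\<lambda>n. (\<Sum>k=1..n. x ^ Omega k) / (real n * ln (real n) powr (x - 1))) \<longlonglongrightarrow> C"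
      hence "(\<lambda>N. \<Prod>p | prime p \<and> p \<le> N. (\<Sum>j. x ^ j * (1 / real p) ^ j) * (1 - 1 / real p) powr x)
           \<longlonglongrightarrow> Gamma x * C"
        using x mean_value_euler_product[of "\<lambda>j. x ^ j" C] by (simp add: mult_ext_Omega power_le_one)
      thus "complex_of_real (Gamma x * C) = Phi_hat_Omega (of_real x) * of_real (w powr (x - 1))"
        using x by (intro Omega_euler_product[OF w]) auto
    qed (auto simp: D_eq)
  }
qed

end
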